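(* Let $q\ge 1$ be an integer. If $K$ is a continuous, zonal and $L^2$-positive definite kernel on $\Omega_{2q}$, then there exists an $L^2$-positive definite kernel $P$ in $\mathcal{B}^2(\Omega_{2q}^2)$ such that $K=P*P$.
   Context: $\Omega_{2q}$ is the unit sphere of $\mathbb{C}^q$, $\sigma_q$ its (rotation invariant) surface measure, and $\omega_q=2\pi^q/(q-1)!$ its total measure (so for $q=1$ it is the unit circle with arc length measure of total mass $2\pi$). A kernel on $\Omega_{2q}$ is a complex function on $\Omega_{2q}^2:=\Omega_{2q}\times\Omega_{2q}$; $L^2(\Omega_{2q})=L^2(\Omega_{2q},\sigma_q)$ and $L^2(\Omega_{2q}^2)=L^2(\Omega_{2q}^2,\sigma_q\times\sigma_q)$, with elements treated as functions and equality understood almost everywhere. A kernel $K$ is zonal if $K(\rho(x),\rho(y))=K(x,y)$ for all $x,y\in\Omega_{2q}$ and all unitary linear operators $\rho$ on $\mathbb{C}^q$. $\mathcal{B}^2(\Omega_{2q}^2)$ is the space of all zonal kernels in $L^2(\Omega_{2q}^2)$. A kernel $K\in L^2(\Omega_{2q}^2)$ is $L^2$-positive definite if $\int_{\Omega_{2q}}\big(\int_{\Omega_{2q}}K(x,y)f(y)\,d\sigma_q(y)\big)\overline{f(x)}\,d\sigma_q(x)\ge 0$ for all $f\in L^2(\Omega_{2q})$. The generalized convolution is $(K_1*K_2)(x,y)=\frac{1}{\omega_q}\int_{\Omega_{2q}}K_1(x,\xi)K_2(\xi,y)\,d\sigma_q(\xi)$. *)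

theory Defs
  imports "HOL-Analysis.Analysis"
begin

text \<open>
  Complex \<open>q\<close>-space is \<^typ>\<open>complex ^ 'q\<close> with \<open>q = CARD('q)\<close>; the norm of this type is the
  Euclidean one, so \<open>\<Omega>\<^sub>2\<^sub>q\<close> is \<open>sphere 0 1\<close>. Kernels and functions on the sphere are total functions
  whose values off the sphere are irrelevant: all notions below only look at points of the sphere.
\<close>

abbreviation csphere :: "(complex ^ 'q) set"
  where "csphere \<equiv> sphere 0 1"

text \<open>
  Surface measure in polar coordinates: \<open>\<sigma>(A)\<close> is the real dimension \<open>2q\<close> times the volume of the
  cone \<open>{t x | 0 < t < 1, x \<in> A}\<close>. For \<open>q = 1\<close> this is arc length.
\<close>

definition surface_measure :: "(complex ^ 'q) measure" where
  "surface_measure =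
     scale_measure (of_nat (2 * CARD('q)))
       (distr (restrict_space lborel (ball 0 1 - {0})) (restrict_space borel csphere) sgn)"

definition sphere_area :: "nat \<Rightarrow> real" where
  "sphere_area q = 2 * pi ^ q / fact (q - 1)"

definition hermitian :: "complex ^ 'q \<Rightarrow> complex ^ 'q \<Rightarrow> complex" where
  "hermitian x y = (\<Sum>i\<in>UNIV. x $ i * cnj (y $ i))"

definition unitary_operator :: "(complex ^ 'q \<Rightarrow> complex ^ 'q) \<Rightarrow> bool" where
  "unitary_operator \<rho> \<longleftrightarrow>
     Vector_Spaces.linear (*s) (*s) \<rho> \<and> surj \<rho> \<and>
     (\<forall>x y. hermitian (\<rho> x) (\<rho> y) = hermitian x y)"

definition square_integrable :: "'a measure \<Rightarrow> ('a \<Rightarrow> complex) \<Rightarrow> bool" where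
  "square_integrable M f \<longleftrightarrow> f \<in> borel_measurable M \<and> integrable M (\<lambda>x. (cmod (f x))\<^sup>2)"

definition L2_kernel :: "(complex ^ 'q \<Rightarrow> complex ^ 'q \<Rightarrow> complex) \<Rightarrow> bool" where
  "L2_kernel K \<longleftrightarrow>
     square_integrable (surface_measure \<Otimes>\<^sub>M surface_measure) (\<lambda>(x, y). K x y)"

definition zonal :: "(complex ^ 'q \<Rightarrow> complex ^ 'q \<Rightarrow> complex) \<Rightarrow> bool" where
  "zonal K \<longleftrightarrow>
     (\<forall>\<rho>. unitary_operator \<rho> \<longrightarrow> (\<forall>x\<in>csphere. \<forall>y\<in>csphere. K (\<rho> x) (\<rho> y) = K x y))"

definition zonal_L2_kernels :: "(complex ^ 'q \<Rightarrow> complex ^ 'q \<Rightarrow> complex) set" where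
  "zonal_L2_kernels = {K. L2_kernel K \<and> zonal K}"

text \<open>
  Being \<open>\<ge> 0\<close>, for a complex number, means being a nonnegative real.
\<close>

definition L2_positive_definite :: "(complex ^ 'q \<Rightarrow> complex ^ 'q \<Rightarrow> complex) \<Rightarrow> bool" where
  "L2_positive_definite K \<longleftrightarrow>
     L2_kernel K \<and>
     (\<forall>f. square_integrable surface_measure f \<longrightarrow>
        (LINT x|surface_measure. (LINT y|surface_measure. K x y * f y) * cnj (f x))
          \<in> nonneg_Reals)"

definition gen_convolution ::
    "(complex ^ 'q \<Rightarrow> complex ^ 'q \<Rightarrow> complex) \<Rightarrow> (complex ^ 'q \<Rightarrow> complex ^ 'q \<Rightarrow> complex) \<Rightarrow>
     complex ^ 'q \<Rightarrow> complex ^ 'q \<Rightarrow> complex" where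
  "gen_convolution K\<^sub>1 K\<^sub>2 x y =
     (LINT \<xi>|surface_measure. K\<^sub>1 x \<xi> * K\<^sub>2 \<xi> y) / of_real (sphere_area CARD('q))"

lemma space_surface_measure: "space (surface_measure :: (complex ^ 'q) measure) = csphere"
  by (simp add: surface_measure_def space_scale_measure space_restrict_space)

lemma sets_surface_measure:
  "sets (surface_measure :: (complex ^ 'q) measure) = sets (restrict_space borel csphere)"
  by (simp add: surface_measure_def)

lemma measurable_sgn_cone:
  "(sgn :: complex ^ 'q \<Rightarrow> _) \<in>
     restrict_space lborel (ball 0 1 - {0}) \<rightarrow>\<^sub>M restrict_space borel csphere"
proof (rule measurable_restrict_space2)
  show "(sgn :: complex ^ 'q \<Rightarrow> _) \<in> space (restrict_space lborel (ball 0 1 - {0})) \<rightarrow> csphere"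
    by (auto simp: space_restrict_space norm_sgn)
  have "(sgn :: complex ^ 'q \<Rightarrow> _) \<in> borel_measurable borel"
    unfolding sgn_div_norm[abs_def] by measurable
  then show "(sgn :: complex ^ 'q \<Rightarrow> _) \<in> borel_measurable (restrict_space lborel (ball 0 1 - {0}))"
    by (intro measurable_restrict_space1) simp
qed

lemma emeasure_surface_measure_space:
  "emeasure (surface_measure :: (complex ^ 'q) measure) csphere = ennreal (sphere_area CARD('q))"
proof -
  let ?B = "ball (0 :: complex ^ 'q) 1" and ?q = "CARD('q)"
  have pos: "?q > 0" by simp
  have top: "(csphere :: (complex ^ 'q) set) \<in> sets (restrict_space borel csphere)"
    using sets.top[of "restrict_space borel (csphere :: (complex ^ 'q) set)"]
    by (simp add: space_restrict_space)
  have pre: "sgn -` csphere \<inter> (?B - {0}) = ?B - {0}"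
    by (auto simp: norm_sgn)
  have "emeasure (surface_measure :: (complex ^ 'q) measure) csphere
      = of_nat (2 * ?q) * emeasure (restrict_space lborel (?B - {0})) (?B - {0})"
    unfolding surface_measure_def emeasure_scale_measure
    by (subst emeasure_distr[OF measurable_sgn_cone top])
       (simp add: pre space_restrict_space)
  also have "emeasure (restrict_space lborel (?B - {0})) (?B - {0}) = emeasure lborel (?B - {0})"
    by (subst emeasure_restrict_space) auto
  also have "\<dots> = emeasure lborel ?B"
    by (rule emeasure_Diff_null_set) (auto simp: null_sets_def)
  also have "\<dots> = ennreal (unit_ball_vol (real (2 * ?q)))"
    by (simp add: emeasure_ball mult.commute)
  also have "unit_ball_vol (real (2 * ?q)) = pi ^ ?q / fact ?q"
    by (rule unit_ball_vol_even)
  also have "of_nat (2 * ?q) * ennreal (pi ^ ?q / fact ?q)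
      = ennreal (real (2 * ?q) * (pi ^ ?q / fact ?q))"
    by (subst ennreal_mult') (auto simp: ennreal_of_nat_eq_real_of_nat)
  also have "real (2 * ?q) * (pi ^ ?q / fact ?q) = sphere_area ?q"
    using pos by (simp add: sphere_area_def fact_reduce[of ?q] field_simps)
  finally show ?thesis .
qed

end

theory Submission
  imports Defs
begin

text \<open>
  Let \<open>T f (x) = \<integral> K(x, y) f(y) dy\<close>. The kernel \<open>P\<close> has to be the kernel of the positive square root
  of \<open>T\<close>, up to a constant that absorbs the normalisation of the convolution. Three things need a
  reason: that \<open>T\<^sup>1\<^sup>/\<^sup>2\<close> is an integral operator with a square integrable kernel, that the kernel
  composed with itself gives \<open>K\<close> almost everywhere, and that it can be chosen to be zonal at every
  pair of points and not only almost everywhere. No spectral theorem is used: \<open>P\<close> is obtained as a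
  limit of polynomials in \<open>T\<close> without constant term, whose kernels are sums of iterated
  convolutions of \<open>K\<close> and hence continuous and strictly zonal.

  After scaling \<open>K\<close> so that \<open>0 \<le> T \<le> I\<close>, the polynomials are those of the classical iteration
  \<open>p\<^sub>0 = 0\<close>, \<open>p\<^sub>n\<^sub>+\<^sub>1 = p\<^sub>n + (t - p\<^sub>n\<^sup>2) / 2\<close>, which increases to the square root on the unit interval.
  Written as \<open>t\<close> times a polynomial in \<open>e = 1 - t\<close>, the differences \<open>p\<^sub>n - p\<^sub>m\<close> for \<open>m \<le> n\<close> and the
  residual \<open>t - p\<^sub>n\<^sup>2 = 2 (p\<^sub>n\<^sub>+\<^sub>1 - p\<^sub>n)\<close> have nonnegative coefficients
  (\<open>nonneg_coeffs_sqrt_poly_diff\<close>, \<open>nonneg_coeffs_sqrt_residual\<close>). Since \<open>T (I - T)\<^sup>k\<close> is a positive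
  operator, inequalities between the polynomials become inequalities between operators
  (\<open>poly_kernel_pos\<close>).

  Continuity of \<open>K\<close> enters through the diagonal: a continuous kernel of a positive operator is
  nonnegative on the diagonal (\<open>pos_kernel_diagonal\<close>, by testing against normalised indicator
  functions of small balls). Let \<open>P\<^sub>n\<close> be the kernel of \<open>p\<^sub>n(T)\<close>. As \<open>P\<^sub>n\<close> is Hermitian, the squared
  \<open>L\<^sup>2\<close> norm of \<open>P\<^sub>n(x, \<cdot>)\<close> is the diagonal value \<open>\<alpha>\<^sub>n(x)\<close> of the kernel of \<open>p\<^sub>n(T)\<^sup>2\<close>. The operator
  inequalities give \<open>\<alpha>\<^sub>n(x) \<le> K(x, x)\<close> and
  \<open>\<integral> \<bar>P\<^sub>n(x, y) - P\<^sub>m(x, y)\<bar>\<^sup>2 dy \<le> \<alpha>\<^sub>n(x) - \<alpha>\<^sub>m(x)\<close> for \<open>m \<le> n\<close> (\<open>approx_root_section_dist\<close>), so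
  \<open>P\<^sub>n(x, \<cdot>)\<close> is a Cauchy sequence in \<open>L\<^sup>2\<close> for every \<open>x\<close>, and \<open>P\<^sub>n\<close> is one on the product space.
  The limit of an almost everywhere convergent subsequence, set to \<open>0\<close> where there is no convergence,
  is invariant under every transformation under which all \<open>P\<^sub>n\<close> are, without exceptional sets.
  Positivity and the equation for \<open>K\<close> pass to the limit by convergence of the sections.

  On the sphere it remains to see that the surface measure is invariant under unitary operators; it
  is an image of Lebesgue measure on the ball, and Lebesgue measure is invariant under linear
  isometries by uniqueness of translation invariant measures.
\<close>

section \<open>Square integrable functions\<close>

lemma square_integrable_mult:
  assumes "square_integrable M f" "square_integrable M g"
  shows "integrable M (\<lambda>x. f x * g x)"
proof (rule Bochner_Integration.integrable_bound)
  show "integrable M (\<lambda>x. (cmod (f x))\<^sup>2 + (cmod (g x))\<^sup>2)"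
    using assms by (auto simp: square_integrable_def)
  show "(\<lambda>x. f x * g x) \<in> borel_measurable M"
    using assms by (auto simp: square_integrable_def)
  have "a * b \<le> a\<^sup>2 + b\<^sup>2" if "a \<ge> 0" "b \<ge> 0" for a b :: real
    using sum_squares_bound[of a b] mult_nonneg_nonneg[OF that] by simp
  then show "AE x in M. norm (f x * g x) \<le> norm ((cmod (f x))\<^sup>2 + (cmod (g x))\<^sup>2)"
    by (auto simp: norm_mult)
qed

lemma square_integrable_cnj:
  "square_integrable M f \<Longrightarrow> square_integrable M (\<lambda>x. cnj (f x))"
  using measurable_compose[OF _ borel_measurable_continuous_onI[OF continuous_on_cnj[OF continuous_on_id]], of f M]
  by (auto simp: square_integrable_def)

lemma square_integrable_cmult:
  "square_integrable M f \<Longrightarrow> square_integrable M (\<lambda>x. c * f x)"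
  by (auto simp: square_integrable_def norm_mult power_mult_distrib)

lemma square_integrable_add:
  assumes "square_integrable M f" "square_integrable M g"
  shows "square_integrable M (\<lambda>x. f x + g x)"
  unfolding square_integrable_def
proof
  show "(\<lambda>x. f x + g x) \<in> borel_measurable M"
    using assms by (auto simp: square_integrable_def)
  show "integrable M (\<lambda>x. (cmod (f x + g x))\<^sup>2)"
  proof (rule Bochner_Integration.integrable_bound)
    show "integrable M (\<lambda>x. 2 * (cmod (f x))\<^sup>2 + 2 * (cmod (g x))\<^sup>2)"
      using assms by (auto simp: square_integrable_def)
    show "(\<lambda>x. (cmod (f x + g x))\<^sup>2) \<in> borel_measurable M"
      using assms by (auto simp: square_integrable_def)
    have "(cmod (a + b))\<^sup>2 \<le> 2 * (cmod a)\<^sup>2 + 2 * (cmod b)\<^sup>2" for a b :: complex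
    proof -
      have "(cmod (a + b))\<^sup>2 \<le> (cmod a + cmod b)\<^sup>2"
        by (intro power_mono norm_triangle_ineq norm_ge_zero)
      also have "\<dots> \<le> 2 * (cmod a)\<^sup>2 + 2 * (cmod b)\<^sup>2"
        using sum_squares_bound[of "cmod a" "cmod b"] by (simp add: power2_sum)
      finally show ?thesis .
    qed
    then show "AE x in M. norm ((cmod (f x + g x))\<^sup>2) \<le>
        norm (2 * (cmod (f x))\<^sup>2 + 2 * (cmod (g x))\<^sup>2)"
      by auto
  qed
qed

lemma square_integrable_diff:
  assumes "square_integrable M f" "square_integrable M g"
  shows "square_integrable M (\<lambda>x. f x - g x)"
  using square_integrable_add[OF assms(1) square_integrable_cmult[OF assms(2), of "-1"]] by simp

lemma (in finite_measure) square_integrable_bounded: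
  assumes "f \<in> borel_measurable M" "\<And>x. x \<in> space M \<Longrightarrow> cmod (f x) \<le> B"
  shows "square_integrable M f"
  unfolding square_integrable_def
proof
  show "f \<in> borel_measurable M" by fact
  show "integrable M (\<lambda>x. (cmod (f x))\<^sup>2)"
  proof (rule integrable_const_bound[where B = "B\<^sup>2"])
    show "AE x in M. norm ((cmod (f x))\<^sup>2) \<le> B\<^sup>2"
      using assms(2) by (auto intro!: power_mono)
    show "(\<lambda>x. (cmod (f x))\<^sup>2) \<in> borel_measurable M"
      using assms(1) by measurable
  qed
qed

lemma (in finite_measure) square_integrable_integrable:
  assumes "square_integrable M f" shows "integrable M f"
  using square_integrable_mult[OF assms square_integrable_bounded[of "\<lambda>_. 1" 1]] by simp

lemma Cauchy_Schwarz_L2: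
  assumes f: "square_integrable M f" and g: "square_integrable M g"
  shows "cmod (\<integral>x. f x * g x \<partial>M) \<le>
    sqrt (\<integral>x. (cmod (f x))\<^sup>2 \<partial>M) * sqrt (\<integral>x. (cmod (g x))\<^sup>2 \<partial>M)"
proof -
  have [measurable]: "f \<in> borel_measurable M" "g \<in> borel_measurable M"
    and int: "integrable M (\<lambda>x. (cmod (f x))\<^sup>2)" "integrable M (\<lambda>x. (cmod (g x))\<^sup>2)"
    using f g by (auto simp: square_integrable_def)
  have fg: "integrable M (\<lambda>x. cmod (f x) * cmod (g x))"
    using integrable_norm[OF square_integrable_mult[OF f g]] by (simp add: norm_mult)
  have "ennreal ((\<integral>x. cmod (f x) * cmod (g x) \<partial>M)\<^sup>2) =
      (\<integral>\<^sup>+x. ennreal (cmod (f x)) * ennreal (cmod (g x)) \<partial>M)\<^sup>2"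
    by (simp add: nn_integral_eq_integral[OF fg] ennreal_mult[symmetric] ennreal_power)
  also have "\<dots> \<le> (\<integral>\<^sup>+x. (ennreal (cmod (f x)))\<^sup>2 \<partial>M) * (\<integral>\<^sup>+x. (ennreal (cmod (g x)))\<^sup>2 \<partial>M)"
    by (rule Cauchy_Schwarz_nn_integral) measurable
  also have "\<dots> = ennreal ((\<integral>x. (cmod (f x))\<^sup>2 \<partial>M) * (\<integral>x. (cmod (g x))\<^sup>2 \<partial>M))"
    by (simp add: ennreal_power nn_integral_eq_integral[OF int(1)]
        nn_integral_eq_integral[OF int(2)] ennreal_mult)
  finally have "(\<integral>x. cmod (f x) * cmod (g x) \<partial>M)\<^sup>2 \<le>
      (\<integral>x. (cmod (f x))\<^sup>2 \<partial>M) * (\<integral>x. (cmod (g x))\<^sup>2 \<partial>M)"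
    by (subst (asm) ennreal_le_iff) (auto intro!: mult_nonneg_nonneg integral_nonneg_AE)
  then have "(\<integral>x. cmod (f x) * cmod (g x) \<partial>M) \<le>
      sqrt (\<integral>x. (cmod (f x))\<^sup>2 \<partial>M) * sqrt (\<integral>x. (cmod (g x))\<^sup>2 \<partial>M)"
    unfolding real_sqrt_mult[symmetric] by (rule real_le_rsqrt)
  moreover have "cmod (\<integral>x. f x * g x \<partial>M) \<le> (\<integral>x. cmod (f x) * cmod (g x) \<partial>M)"
    using integral_norm_bound[of M "\<lambda>x. f x * g x"] by (simp add: norm_mult)
  ultimately show ?thesis by simp
qed

text \<open>
  Fatou's lemma for squares. It is used both to place a limit in \<open>L\<^sup>2\<close> and to carry over bounds on
  the distance to a fixed member of a Cauchy sequence.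
\<close>

lemma square_integrable_Fatou:
  fixes u :: "nat \<Rightarrow> 'a \<Rightarrow> complex"
  assumes u: "\<And>k. square_integrable M (u k)" and v: "v \<in> borel_measurable M"
    and lim: "AE x in M. (\<lambda>k. u k x) \<longlonglongrightarrow> v x"
    and bd: "\<forall>\<^sub>F k in sequentially. (\<integral>x. (cmod (u k x))\<^sup>2 \<partial>M) \<le> (B::real)"
  shows "square_integrable M v" "(\<integral>x. (cmod (v x))\<^sup>2 \<partial>M) \<le> B"
proof -
  have [measurable]: "\<And>k. u k \<in> borel_measurable M" "v \<in> borel_measurable M"
    and int: "\<And>k. integrable M (\<lambda>x. (cmod (u k x))\<^sup>2)"
    using u v by (auto simp: square_integrable_def)
  obtain k where "(\<integral>x. (cmod (u k x))\<^sup>2 \<partial>M) \<le> B"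
    using eventually_happens[OF bd] by auto
  then have B: "B \<ge> 0"
    using order_trans[OF integral_nonneg_AE[of "\<lambda>x. (cmod (u k x))\<^sup>2" M]] by simp
  have "(\<integral>\<^sup>+x. ennreal ((cmod (v x))\<^sup>2) \<partial>M) =
      (\<integral>\<^sup>+x. liminf (\<lambda>k. ennreal ((cmod (u k x))\<^sup>2)) \<partial>M)"
  proof (rule nn_integral_cong_AE)
    show "AE x in M. ennreal ((cmod (v x))\<^sup>2) = liminf (\<lambda>k. ennreal ((cmod (u k x))\<^sup>2))"
      using lim
    proof eventually_elim
      case (elim x)
      then have "(\<lambda>k. ennreal ((cmod (u k x))\<^sup>2)) \<longlonglongrightarrow> ennreal ((cmod (v x))\<^sup>2)"
        by (intro tendsto_ennrealI tendsto_power tendsto_norm)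
      then show ?case
        by (rule lim_imp_Liminf[OF trivial_limit_sequentially, symmetric])
    qed
  qed
  also have "\<dots> \<le> liminf (\<lambda>k. \<integral>\<^sup>+x. ennreal ((cmod (u k x))\<^sup>2) \<partial>M)"
    by (rule nn_integral_liminf) measurable
  also have "\<dots> = liminf (\<lambda>k. ennreal (\<integral>x. (cmod (u k x))\<^sup>2 \<partial>M))"
    by (simp add: nn_integral_eq_integral[OF int])
  also have "\<dots> \<le> liminf (\<lambda>k. ennreal B)"
    by (rule Liminf_mono, use bd in eventually_elim) (simp add: ennreal_leI)
  also have "\<dots> = ennreal B" by (simp add: Liminf_const)
  finally have *: "(\<integral>\<^sup>+x. ennreal ((cmod (v x))\<^sup>2) \<partial>M) \<le> ennreal B" .
  then have iv: "integrable M (\<lambda>x. (cmod (v x))\<^sup>2)"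
    by (intro integrableI_bounded) (auto intro: le_less_trans)
  then show "square_integrable M v"
    using v by (simp add: square_integrable_def)
  from * show "(\<integral>x. (cmod (v x))\<^sup>2 \<partial>M) \<le> B"
    by (simp add: nn_integral_eq_integral[OF iv] B)
qed

lemma tendsto_integral_mult_L2:
  assumes u: "\<And>k. square_integrable M (u k)" "square_integrable M u0"
    and v: "\<And>k. square_integrable M (v k)" "square_integrable M v0"
    and limu: "(\<lambda>k. \<integral>x. (cmod (u k x - u0 x))\<^sup>2 \<partial>M) \<longlonglongrightarrow> 0"
    and limv: "(\<lambda>k. \<integral>x. (cmod (v k x - v0 x))\<^sup>2 \<partial>M) \<longlonglongrightarrow> 0"
  shows "(\<lambda>k. \<integral>x. u k x * v k x \<partial>M) \<longlonglongrightarrow> (\<integral>x. u0 x * v0 x \<partial>M)"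
proof -
  let ?a = "\<lambda>k. \<integral>x. (u k x - u0 x) * (v k x - v0 x) \<partial>M"
  let ?b = "\<lambda>k. \<integral>x. (u k x - u0 x) * v0 x \<partial>M"
  let ?c = "\<lambda>k. \<integral>x. u0 x * (v k x - v0 x) \<partial>M"
  let ?N = "\<lambda>f. sqrt (\<integral>x. (cmod (f x))\<^sup>2 \<partial>M)"
  have du: "square_integrable M (\<lambda>x. u k x - u0 x)" for k
    by (intro square_integrable_diff u)
  have dv: "square_integrable M (\<lambda>x. v k x - v0 x)" for k
    by (intro square_integrable_diff v)
  have nu: "(\<lambda>k. ?N (\<lambda>x. u k x - u0 x)) \<longlonglongrightarrow> 0"
    using tendsto_real_sqrt[OF limu] by simp
  have nv: "(\<lambda>k. ?N (\<lambda>x. v k x - v0 x)) \<longlonglongrightarrow> 0"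
    using tendsto_real_sqrt[OF limv] by simp
  have a: "?a \<longlonglongrightarrow> 0"
    by (rule Lim_null_comparison[OF _ tendsto_mult_zero[OF nu nv]])
       (intro always_eventually allI Cauchy_Schwarz_L2 du dv)
  have b: "?b \<longlonglongrightarrow> 0"
    by (rule Lim_null_comparison[OF _ tendsto_mult_left_zero[OF nu, of "?N v0"]])
       (intro always_eventually allI Cauchy_Schwarz_L2 du v)
  have c: "?c \<longlonglongrightarrow> 0"
    by (rule Lim_null_comparison[OF _ tendsto_mult_right_zero[OF nv, of "?N u0"]])
       (intro always_eventually allI Cauchy_Schwarz_L2 dv u)
  have eq: "(\<integral>x. u k x * v k x \<partial>M) = ?a k + ?b k + ?c k + (\<integral>x. u0 x * v0 x \<partial>M)" for k
  proof -
    note i = square_integrable_mult[OF du dv] square_integrable_mult[OF du v(2)]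
      square_integrable_mult[OF u(2) dv] square_integrable_mult[OF u(2) v(2)]
    have "(\<integral>x. u k x * v k x \<partial>M) = (\<integral>x. (u k x - u0 x) * (v k x - v0 x) +
        (u k x - u0 x) * v0 x + u0 x * (v k x - v0 x) + u0 x * v0 x \<partial>M)"
      by (rule Bochner_Integration.integral_cong) (auto simp: algebra_simps)
    then show ?thesis
      by (simp add: i)
  qed
  show ?thesis
    unfolding eq using tendsto_add[OF tendsto_add[OF tendsto_add[OF a b] c] tendsto_const] by simp
qed

section \<open>Unitary invariance of the surface measure\<close>

text \<open>
  Both sides of \<open>\<lambda>(B) \<mu>(A) = \<lambda>(A) \<mu>(B)\<close> are the double integral of the indicator of
  \<open>x \<in> A, x + y \<in> B\<close> over \<open>\<lambda> \<times> \<mu>\<close>: integrating over \<open>y\<close> first gives the left-hand side by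
  invariance of \<open>\<lambda>\<close>; translating \<open>x\<close> by \<open>- y\<close> first, by invariance of \<open>\<mu>\<close>, gives the right-hand side.
  The unit ball for \<open>B\<close> fixes the constant of proportionality.
\<close>

lemma lborel_unique_translation_invariant:
  fixes \<mu> :: "'a::euclidean_space measure"
  assumes sets: "sets \<mu> = sets borel" and sf: "sigma_finite_measure \<mu>"
    and inv: "\<And>c. distr \<mu> borel ((+) c) = \<mu>"
    and ball: "emeasure \<mu> (ball 0 1) = emeasure lborel (ball 0 1 :: 'a set)"
  shows "\<mu> = lborel"
proof (rule measure_eqI)
  show "sets \<mu> = sets lborel" using sets by simp
  interpret \<mu>: sigma_finite_measure \<mu> by fact
  interpret P: pair_sigma_finite lborel \<mu> ..
  note [measurable_cong] = sets
  define B where "B = ball (0 :: 'a) 1"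
  have B[measurable]: "B \<in> sets borel" by (simp add: B_def)
  have B_ne: "emeasure lborel B \<noteq> 0" "emeasure lborel B \<noteq> top"
    by (simp_all add: B_def emeasure_ball less_imp_neq[OF unit_ball_vol_pos, symmetric])
  have trans: "(\<integral>\<^sup>+x. g (c + x) \<partial>\<nu>) = (\<integral>\<^sup>+x. g x \<partial>\<nu>)"
    if [measurable]: "g \<in> borel_measurable borel" and \<nu>: "distr \<nu> borel ((+) c) = \<nu>"
      and [measurable_cong]: "sets \<nu> = sets borel" for g \<nu> and c :: 'a
  proof -
    have "(\<integral>\<^sup>+x. g x \<partial>\<nu>) = (\<integral>\<^sup>+x. g x \<partial>distr \<nu> borel ((+) c))"
      by (simp add: \<nu>)
    also have "\<dots> = (\<integral>\<^sup>+x. g (c + x) \<partial>\<nu>)"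
      by (rule nn_integral_distr) measurable
    finally show ?thesis by simp
  qed
  fix A assume "A \<in> sets \<mu>"
  then have A[measurable]: "A \<in> sets borel" using sets by simp
  have refl: "(\<integral>\<^sup>+y. indicator A (x - y) \<partial>lborel) = emeasure lborel A" for x :: 'a
  proof -
    have "(\<integral>\<^sup>+y. indicator A (x - y) \<partial>lborel) = (\<integral>\<^sup>+y. indicator A y \<partial>distr lborel borel (\<lambda>y. x + (-1) *\<^sub>R y))"
      by (subst nn_integral_distr) auto
    also have "distr lborel borel (\<lambda>y. x + (-1) *\<^sub>R y) = (lborel :: 'a measure)"
      by (subst (2) lborel_affine[of "-1" x]) (simp_all add: density_1)
    finally show ?thesis by simp
  qed
  have "emeasure lborel B * emeasure \<mu> A
      = (\<integral>\<^sup>+x. indicator A x * (\<integral>\<^sup>+y. indicator B (x + y) \<partial>lborel) \<partial>\<mu>)"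
    using trans[OF borel_measurable_indicator[OF B] lborel_distr_plus sets_lborel]
    by (simp add: nn_integral_multc mult.commute[of "emeasure lborel B"])
  also have "\<dots> = (\<integral>\<^sup>+x. (\<integral>\<^sup>+y. indicator A x * indicator B (x + y) \<partial>lborel) \<partial>\<mu>)"
    by (intro nn_integral_cong nn_integral_cmult[symmetric]) measurable
  also have "\<dots> = (\<integral>\<^sup>+y. (\<integral>\<^sup>+x. indicator A x * indicator B (x + y) \<partial>\<mu>) \<partial>lborel)"
    by (rule P.Fubini') measurable
  also have "\<dots> = (\<integral>\<^sup>+y. (\<integral>\<^sup>+x. indicator A (x - y) * indicator B x \<partial>\<mu>) \<partial>lborel)"
  proof (rule nn_integral_cong)
    fix y :: 'a
    have "(\<integral>\<^sup>+x. indicator A (- y + x) * indicator B (- y + x + y) \<partial>\<mu>) =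
        (\<integral>\<^sup>+x. indicator A x * indicator B (x + y) \<partial>\<mu>)"
      by (rule trans[OF _ inv sets]) measurable
    then show "(\<integral>\<^sup>+x. indicator A x * indicator B (x + y) \<partial>\<mu>) =
        (\<integral>\<^sup>+x. indicator A (x - y) * indicator B x \<partial>\<mu>)"
      by (simp add: algebra_simps)
  qed
  also have "\<dots> = (\<integral>\<^sup>+x. (\<integral>\<^sup>+y. indicator A (x - y) * indicator B x \<partial>lborel) \<partial>\<mu>)"
    by (rule P.Fubini'[symmetric]) measurable
  also have "\<dots> = (\<integral>\<^sup>+x. emeasure lborel A * indicator B x \<partial>\<mu>)"
    by (simp add: nn_integral_multc refl)
  also have "\<dots> = emeasure lborel A * emeasure \<mu> B"
    by (simp add: nn_integral_cmult)
  finally have eq: "emeasure lborel B * emeasure \<mu> A = emeasure lborel B * emeasure lborel A"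
    by (simp add: ball[folded B_def] mult.commute)
  with B_ne show "emeasure \<mu> A = emeasure lborel A"
    by (simp add: ennreal_mult_cancel_left)
qed

text \<open>
  The image measure is again translation invariant because a linear bijection conjugates
  translations to translations, and an isometry preserves the unit ball.
\<close>

lemma lborel_distr_linear_isometry:
  fixes f :: "'a::euclidean_space \<Rightarrow> 'a"
  assumes lin: "linear f" and norm: "\<And>x. norm (f x) = norm x"
  shows "distr lborel borel f = lborel"
proof (rule lborel_unique_translation_invariant)
  have f[measurable]: "f \<in> borel_measurable borel"
    by (intro borel_measurable_continuous_onI linear_continuous_on linear_conv_bounded_linear[THEN iffD1] lin)
  have inj: "inj f"
    using norm by (intro linear_injective_0[OF lin, THEN iffD2]) (metis norm_eq_zero)
  then have surj: "surj f"
    using linear_injective_imp_surjective[OF lin] by blast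
  have vb: "f -` ball 0 r = ball 0 r" for r
    by (auto simp: norm)
  show "sets (distr lborel borel f) = sets borel" by simp
  show "emeasure (distr lborel borel f) (ball 0 1) = emeasure lborel (ball 0 1 :: 'a set)"
    by (simp add: emeasure_distr vb)
  show "sigma_finite_measure (distr lborel borel f)"
  proof
    show "\<exists>A. countable A \<and> A \<subseteq> sets (distr lborel borel f) \<and> \<Union>A = space (distr lborel borel f) \<and>
        (\<forall>a\<in>A. emeasure (distr lborel borel f) a \<noteq> \<infinity>)"
      by (rule exI[of _ "range (\<lambda>n::nat. ball 0 (real n))"])
         (auto simp: emeasure_distr vb emeasure_ball intro: reals_Archimedean2)
  qed
  show "distr (distr lborel borel f) borel ((+) c) = distr lborel borel f" for c
  proof -
    obtain d where d: "c = f d" using surj by blast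
    have eq: "(+) c \<circ> f = f \<circ> (+) d"
      using linear_add[OF lin] by (auto simp: d)
    have "distr (distr lborel borel f) borel ((+) c) = distr lborel borel ((+) c \<circ> f)"
      by (rule distr_distr) measurable
    also have "\<dots> = distr (distr lborel borel ((+) d)) borel f"
      unfolding eq by (rule distr_distr[symmetric]) measurable
    finally show ?thesis by (simp add: lborel_distr_plus)
  qed
qed

lemma hermitian_self: "hermitian x x = of_real ((norm x)\<^sup>2)"
proof -
  have "(norm x)\<^sup>2 = (\<Sum>i\<in>UNIV. (cmod (x $ i))\<^sup>2)"
    by (simp add: norm_vec_def L2_set_def sum_nonneg)
  then show ?thesis
    by (simp add: hermitian_def complex_norm_square[symmetric])
qed

lemma unitary_operator_norm:
  assumes "unitary_operator \<rho>" shows "norm (\<rho> x) = norm x"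
proof -
  have "hermitian (\<rho> x) (\<rho> x) = hermitian x x"
    using assms by (simp add: unitary_operator_def)
  then have "(norm (\<rho> x))\<^sup>2 = (norm x)\<^sup>2"
    unfolding hermitian_self of_real_eq_iff .
  then show ?thesis by simp
qed

lemma unitary_operator_linear:
  assumes "unitary_operator \<rho>" shows "linear \<rho>"
proof -
  interpret \<rho>: Vector_Spaces.linear "(*s)" "(*s)" \<rho>
    using assms by (simp add: unitary_operator_def)
  have sc: "r *\<^sub>R x = complex_of_real r *s x" for r and x :: "complex ^ 'a"
    unfolding vec_eq_iff vector_scaleR_component vector_smult_component by (simp only: scaleR_conv_of_real) simp
  show ?thesis
    by (rule linearI) (simp_all add: \<rho>.add sc \<rho>.scale)
qed

lemma surface_measure_eq:
  assumes "A \<in> sets (restrict_space borel (csphere :: (complex ^ 'q) set))"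
  shows "emeasure surface_measure A = of_nat (2 * CARD('q)) *
    emeasure lborel {x \<in> ball 0 1 - {0}. sgn x \<in> A}"
proof -
  let ?B = "ball 0 1 - {0} :: (complex ^ 'q) set"
  have "emeasure surface_measure A = of_nat (2 * CARD('q)) *
      emeasure (restrict_space lborel ?B) (sgn -` A \<inter> ?B)"
    unfolding surface_measure_def emeasure_scale_measure
    by (subst emeasure_distr[OF measurable_sgn_cone assms]) (simp add: space_restrict_space)
  also have "emeasure (restrict_space lborel ?B) (sgn -` A \<inter> ?B) = emeasure lborel (sgn -` A \<inter> ?B)"
    by (rule emeasure_restrict_space) auto
  also have "sgn -` A \<inter> ?B = {x \<in> ?B. sgn x \<in> A}" by auto
  finally show ?thesis .
qed

lemma cone_measurable:
  assumes "A \<in> sets (restrict_space borel (csphere :: (complex ^ 'q) set))"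
  shows "{x \<in> ball 0 1 - {0}. sgn x \<in> A} \<in> sets borel"
proof -
  let ?B = "ball 0 1 - {0} :: (complex ^ 'q) set"
  have "sgn -` A \<inter> ?B \<in> sets (restrict_space lborel ?B)"
    using measurable_sets[OF measurable_sgn_cone assms] by (simp add: space_restrict_space)
  then have "sgn -` A \<inter> ?B \<in> sets borel"
    by (subst (asm) sets_restrict_space_iff) auto
  moreover have "sgn -` A \<inter> ?B = {x \<in> ?B. sgn x \<in> A}" by auto
  ultimately show ?thesis by simp
qed

lemma measurable_unitary_sphere:
  fixes \<rho> :: "complex ^ 'q \<Rightarrow> complex ^ 'q"
  assumes \<rho>: "unitary_operator \<rho>"
  shows "\<rho> \<in> surface_measure \<rightarrow>\<^sub>M surface_measure"
proof -
  have "\<rho> \<in> borel_measurable borel"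
    by (intro borel_measurable_continuous_onI linear_continuous_on
        linear_conv_bounded_linear[THEN iffD1] unitary_operator_linear \<rho>)
  then have "\<rho> \<in> restrict_space borel csphere \<rightarrow>\<^sub>M restrict_space borel csphere"
    by (intro measurable_restrict_space2 measurable_restrict_space1)
       (auto simp: space_restrict_space unitary_operator_norm[OF \<rho>])
  then show ?thesis
    by (simp cong: measurable_cong_sets add: sets_surface_measure)
qed

text \<open>
  A linear isometry commutes with \<^term>\<open>sgn\<close> and with the formation of cones, so the
  claim reduces to the invariance of Lebesgue measure on the ball.
\<close>

lemma distr_surface_measure_unitary:
  fixes \<rho> :: "complex ^ 'q \<Rightarrow> complex ^ 'q"
  assumes \<rho>: "unitary_operator \<rho>"
  shows "distr surface_measure surface_measure \<rho> = surface_measure"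
proof (rule measure_eqI)
  note lin = unitary_operator_linear[OF \<rho>] and nrm = unitary_operator_norm[OF \<rho>]
  have [measurable]: "\<rho> \<in> borel_measurable borel"
    by (intro borel_measurable_continuous_onI linear_continuous_on
        linear_conv_bounded_linear[THEN iffD1] lin)
  have sgn: "sgn (\<rho> x) = \<rho> (sgn x)" for x
    by (simp add: sgn_div_norm nrm linear_scale[OF lin])
  have z: "\<rho> x = 0 \<longleftrightarrow> x = 0" for x
    using nrm[of x] by (metis norm_eq_zero)
  fix A assume "A \<in> sets (distr surface_measure surface_measure \<rho>)"
  then have A: "A \<in> sets surface_measure"
    and A': "A \<in> sets (restrict_space borel (csphere :: (complex ^ 'q) set))"
    by (simp_all add: sets_surface_measure)
  let ?A = "\<rho> -` A \<inter> space surface_measure"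
  have rA: "?A \<in> sets (restrict_space borel (csphere :: (complex ^ 'q) set))"
    using measurable_sets[OF measurable_unitary_sphere[OF \<rho>] A] by (simp add: sets_surface_measure)
  have "emeasure (distr surface_measure surface_measure \<rho>) A = emeasure surface_measure ?A"
    by (rule emeasure_distr[OF measurable_unitary_sphere[OF \<rho>] A])
  also have "\<dots> = of_nat (2 * CARD('q)) * emeasure lborel {x \<in> ball 0 1 - {0}. sgn x \<in> ?A}"
    by (rule surface_measure_eq[OF rA])
  also have "{x \<in> ball 0 1 - {0}. sgn x \<in> ?A} = \<rho> -` {x \<in> ball 0 1 - {0}. sgn x \<in> A}"
    by (auto simp: sgn nrm z space_surface_measure norm_sgn)
  also have "emeasure lborel \<dots> = emeasure (distr lborel borel \<rho>) {x \<in> ball 0 1 - {0}. sgn x \<in> A}"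
    using cone_measurable[OF A'] by (subst emeasure_distr) simp_all
  also have "\<dots> = emeasure lborel {x \<in> ball 0 1 - {0}. sgn x \<in> A}"
    by (simp add: lborel_distr_linear_isometry[OF lin nrm])
  also have "of_nat (2 * CARD('q)) * \<dots> = emeasure surface_measure A"
    by (rule surface_measure_eq[OF A', symmetric])
  finally show "emeasure (distr surface_measure surface_measure \<rho>) A = emeasure surface_measure A" .
qed simp

lemma surface_measure_open_pos:
  fixes U :: "(complex ^ 'q) set"
  assumes U: "open U" and ne: "U \<inter> csphere \<noteq> {}"
  shows "emeasure surface_measure (U \<inter> csphere) > 0"
proof -
  let ?V = "{x \<in> ball 0 1 - {0}. sgn x \<in> U \<inter> csphere} :: (complex ^ 'q) set"
  have "U \<inter> csphere \<in> sets (restrict_space borel (csphere :: (complex ^ 'q) set))"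
    using U by (auto simp: sets_restrict_space)
  note eq = surface_measure_eq[OF this]
  have "?V = sgn -` U \<inter> (ball 0 1 - {0})"
    by (auto simp: norm_sgn)
  moreover have "open (sgn -` U \<inter> (ball 0 1 - {0} :: (complex ^ 'q) set))"
  proof (subst Int_commute, rule continuous_open_preimage[OF _ _ U])
    show "continuous_on (ball 0 1 - {0}) (sgn :: complex ^ 'q \<Rightarrow> _)"
      unfolding sgn_div_norm[abs_def]
      by (intro continuous_on_scaleR continuous_on_inverse continuous_on_norm continuous_on_id) auto
  qed auto
  ultimately have op: "open ?V" by simp
  obtain x where x: "x \<in> U" "norm x = 1" using ne by auto
  then have "(1/2) *\<^sub>R x \<in> ?V"
    by (auto simp: sgn_div_norm)
  then have "\<not> negligible ?V"
    using op open_not_negligible by blast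
  then have "emeasure lborel ?V > 0"
    using op by (auto simp: negligible_iff_null_sets null_sets_def null_sets_completion_iff zero_less_iff_neq_zero)
  then show ?thesis
    unfolding eq by (simp add: ennreal_zero_less_mult_iff)
qed

section \<open>Polynomials approximating the square root\<close>

text \<open>
  The variable of the polynomials stands for \<open>e = I - T\<close>, and a polynomial \<open>p\<close> encodes the operator
  \<open>T p(I - T)\<close>. With \<open>0 \<le> T \<le> I\<close>, nonnegative coefficients make this operator positive; unlike
  pointwise positivity on the unit interval, the condition is visibly closed under sums and products.
\<close>

definition nonneg_coeffs :: "real poly \<Rightarrow> bool" where
  "nonneg_coeffs p \<longleftrightarrow> (\<forall>k. coeff p k \<ge> 0)"

lemma nonneg_coeffs_add: "nonneg_coeffs p \<Longrightarrow> nonneg_coeffs r \<Longrightarrow> nonneg_coeffs (p + r)"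
  by (simp add: nonneg_coeffs_def)

lemma nonneg_coeffs_mult: "nonneg_coeffs p \<Longrightarrow> nonneg_coeffs r \<Longrightarrow> nonneg_coeffs (p * r)"
  by (auto simp: nonneg_coeffs_def coeff_mult intro!: sum_nonneg)

lemma nonneg_coeffs_smult: "a \<ge> 0 \<Longrightarrow> nonneg_coeffs p \<Longrightarrow> nonneg_coeffs (smult a p)"
  by (simp add: nonneg_coeffs_def)

lemma nonneg_coeffs_0: "nonneg_coeffs 0"
  by (simp add: nonneg_coeffs_def)

lemma nonneg_coeffs_pCons: "a \<ge> 0 \<Longrightarrow> nonneg_coeffs p \<Longrightarrow> nonneg_coeffs (pCons a p)"
  by (auto simp: nonneg_coeffs_def coeff_pCons split: nat.split)

text \<open>
  This is the operator \<open>T\<close> itself, expressed through \<open>e = I - T\<close>.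
\<close>

definition one_minus_X :: "real poly" where
  "one_minus_X = [:1, -1:]"

lemma pCons_0_one_minus_X: "pCons 0 p = p - one_minus_X * p"
  by (simp add: one_minus_X_def)

text \<open>
  The iteration \<open>p\<^sub>n\<^sub>+\<^sub>1 = p\<^sub>n + (t - p\<^sub>n\<^sup>2) / 2\<close> for the square root of \<open>t\<close>, divided by \<open>t\<close>: the iterates are
  \<open>p\<^sub>n = t \<cdot> sqrt_poly n\<close> with \<open>t = 1 - e\<close>.
\<close>

fun sqrt_poly :: "nat \<Rightarrow> real poly" where
  "sqrt_poly 0 = 0"
| "sqrt_poly (Suc n) = sqrt_poly n + smult (1/2) (1 - one_minus_X * (sqrt_poly n)\<^sup>2)"

text \<open>
  The quotient \<open>(p\<^sub>n\<^sub>+\<^sub>1 - p\<^sub>n) / t\<close>.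
\<close>

definition sqrt_step :: "nat \<Rightarrow> real poly" where
  "sqrt_step n = smult (1/2) (1 - one_minus_X * (sqrt_poly n)\<^sup>2)"

text \<open>
  The complementary iterates \<open>q\<^sub>n = 1 - p\<^sub>n\<close>, for which the iteration reads \<open>q\<^sub>n\<^sub>+\<^sub>1 = (e + q\<^sub>n\<^sup>2) / 2\<close> and
  visibly preserves nonnegative coefficients.
\<close>

definition sqrt_compl :: "nat \<Rightarrow> real poly" where
  "sqrt_compl n = 1 - one_minus_X * sqrt_poly n"

lemma sqrt_poly_Suc: "sqrt_poly (Suc n) = sqrt_poly n + sqrt_step n"
  by (simp add: sqrt_step_def)

lemma sqrt_compl_Suc: "sqrt_compl (Suc n) = smult (1/2) ([:0, 1:] + (sqrt_compl n)\<^sup>2)"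
proof -
  define h where "h = [:1/2 :: real:]"
  have e: "[:0, 1:] = 1 - one_minus_X" by (simp add: one_minus_X_def one_pCons)
  have h: "2 * h = 1" by (simp add: h_def numeral_poly one_pCons)
  have s: "smult (1/2) p = h * p" for p by (simp add: h_def)
  show ?thesis
    unfolding sqrt_compl_def sqrt_poly.simps e s
    using h by algebra
qed

text \<open>
  The steps shrink by the factor \<open>(q\<^sub>n + q\<^sub>n\<^sub>+\<^sub>1) / 2\<close>, since \<open>p\<^sub>n\<^sub>+\<^sub>1\<^sup>2 - p\<^sub>n\<^sup>2\<close> has the factor
  \<open>p\<^sub>n + p\<^sub>n\<^sub>+\<^sub>1\<close>. Hence all steps inherit nonnegative coefficients from the first one.
\<close>

lemma sqrt_step_Suc:
  "sqrt_step (Suc n) = smult (1/2) (sqrt_step n * (sqrt_compl n + sqrt_compl (Suc n)))"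
proof -
  define h where "h = [:1/2 :: real:]"
  have h: "2 * h = 1" by (simp add: h_def numeral_poly one_pCons)
  have s: "smult (1/2) p = h * p" for p by (simp add: h_def)
  show ?thesis
    unfolding sqrt_compl_def sqrt_step_def sqrt_poly.simps s
    using h by algebra
qed

lemma nonneg_coeffs_sqrt_compl: "nonneg_coeffs (sqrt_compl n)"
proof (induction n)
  case 0
  show ?case by (simp add: sqrt_compl_def one_pCons nonneg_coeffs_pCons nonneg_coeffs_0)
next
  case (Suc n)
  then show ?case
    unfolding sqrt_compl_Suc power2_eq_square
    by (intro nonneg_coeffs_smult nonneg_coeffs_add nonneg_coeffs_mult nonneg_coeffs_pCons
        nonneg_coeffs_0) auto
qed

lemma nonneg_coeffs_sqrt_step: "nonneg_coeffs (sqrt_step n)"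
proof (induction n)
  case 0
  show ?case by (simp add: sqrt_step_def one_pCons nonneg_coeffs_pCons nonneg_coeffs_0)
next
  case (Suc n)
  then show ?case
    unfolding sqrt_step_Suc
    by (intro nonneg_coeffs_smult nonneg_coeffs_add nonneg_coeffs_mult nonneg_coeffs_sqrt_compl) auto
qed

lemma nonneg_coeffs_sqrt_residual: "nonneg_coeffs (1 - one_minus_X * (sqrt_poly n)\<^sup>2)"
  using nonneg_coeffs_sqrt_step[of n] by (simp add: sqrt_step_def nonneg_coeffs_def)

lemma nonneg_coeffs_sqrt_poly_diff:
  assumes "m \<le> n" shows "nonneg_coeffs (sqrt_poly n - sqrt_poly m)"
  using assms
proof (induction rule: dec_induct)
  case base
  show ?case by (simp add: nonneg_coeffs_0)
next
  case (step k)
  have "sqrt_poly (Suc k) - sqrt_poly m = (sqrt_poly k - sqrt_poly m) + sqrt_step k"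
    by (simp add: sqrt_poly_Suc del: sqrt_poly.simps(2))
  with step show ?case
    by (metis nonneg_coeffs_add nonneg_coeffs_sqrt_step)
qed

lemma nonneg_coeffs_sqrt_poly: "nonneg_coeffs (sqrt_poly n)"
  using nonneg_coeffs_sqrt_poly_diff[of 0 n] by simp

section \<open>Continuous kernels on a compact measure space\<close>

text \<open>
  The setting in which a continuous kernel is determined by its integral operator: on a compact
  space with a finite Borel measure that charges every nonempty open set.
\<close>

locale compact_measure_space = finite_measure M
  for M :: "'a :: {metric_space, second_countable_topology} measure" +
  assumes compact_space: "compact (space M)"
    and sets_eq_borel: "sets M = sets (restrict_space borel (space M))"
    and open_pos: "\<And>U. open U \<Longrightarrow> U \<inter> space M \<noteq> {} \<Longrightarrow> emeasure M (U \<inter> space M) > 0"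
begin

sublocale pair_sigma_finite M M ..

text \<open>
  Kernels vanish off the space, so that they are bounded everywhere and identities between integral
  operators hold as equations of total functions.
\<close>

definition cont_kernel :: "('a \<Rightarrow> 'a \<Rightarrow> complex) \<Rightarrow> bool" where
  "cont_kernel A \<longleftrightarrow> continuous_on (space M \<times> space M) (\<lambda>(x, y). A x y) \<and>
     (\<forall>x y. x \<notin> space M \<or> y \<notin> space M \<longrightarrow> A x y = 0)"

definition int_op :: "('a \<Rightarrow> 'a \<Rightarrow> complex) \<Rightarrow> ('a \<Rightarrow> complex) \<Rightarrow> 'a \<Rightarrow> complex" where
  "int_op A f x = (\<integral>y. A x y * f y \<partial>M)"

definition kernel_comp :: "('a \<Rightarrow> 'a \<Rightarrow> complex) \<Rightarrow> ('a \<Rightarrow> 'a \<Rightarrow> complex) \<Rightarrow> 'a \<Rightarrow> 'a \<Rightarrow> complex" where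
  "kernel_comp A B x y = (\<integral>\<xi>. A x \<xi> * B \<xi> y \<partial>M)"

definition inner_L2 :: "('a \<Rightarrow> complex) \<Rightarrow> ('a \<Rightarrow> complex) \<Rightarrow> complex" where
  "inner_L2 f g = (\<integral>x. f x * cnj (g x) \<partial>M)"

definition pos_kernel :: "('a \<Rightarrow> 'a \<Rightarrow> complex) \<Rightarrow> bool" where
  "pos_kernel A \<longleftrightarrow> (\<forall>f. square_integrable M f \<longrightarrow> inner_L2 (int_op A f) f \<in> nonneg_Reals)"

lemma kernel_comp_int_op: "kernel_comp A B x y = int_op A (\<lambda>\<xi>. B \<xi> y) x"
  by (simp add: kernel_comp_def int_op_def)

lemma cont_kernel_outside: "cont_kernel A \<Longrightarrow> x \<notin> space M \<or> y \<notin> space M \<Longrightarrow> A x y = 0"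
  by (auto simp: cont_kernel_def)

lemma cont_kernel_bounded:
  assumes "cont_kernel A"
  obtains B where "B \<ge> 0" "\<And>x y. cmod (A x y) \<le> B"
proof -
  have "compact ((\<lambda>(x, y). A x y) ` (space M \<times> space M))"
    using assms compact_space by (intro compact_continuous_image compact_Times) (auto simp: cont_kernel_def)
  then obtain B where "B > 0" and B: "\<forall>z\<in>(\<lambda>(x, y). A x y) ` (space M \<times> space M). norm z \<le> B"
    using compact_imp_bounded bounded_pos by metis
  have "cmod (A x y) \<le> B" for x y
    using B \<open>B > 0\<close> cont_kernel_outside[OF assms, of x y]
    by (cases "x \<in> space M \<and> y \<in> space M") force+
  then show ?thesis using that[of B] \<open>B > 0\<close> by simp
qed

lemma measurable_into_borel: "(\<lambda>x. x) \<in> M \<rightarrow>\<^sub>M borel"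
proof -
  have "(\<lambda>x. x) \<in> restrict_space borel (space M) \<rightarrow>\<^sub>M borel"
    by (intro measurable_restrict_space1) simp
  then show ?thesis
    using measurable_cong_sets[OF sets_eq_borel refl] by auto
qed

lemma cont_kernel_measurable:
  assumes "cont_kernel A" shows "(\<lambda>(x, y). A x y) \<in> borel_measurable (M \<Otimes>\<^sub>M M)"
proof -
  have f: "(\<lambda>p. fst p) \<in> M \<Otimes>\<^sub>M M \<rightarrow>\<^sub>M borel" "(\<lambda>p. snd p) \<in> M \<Otimes>\<^sub>M M \<rightarrow>\<^sub>M borel"
    using measurable_compose[OF measurable_fst measurable_into_borel]
      measurable_compose[OF measurable_snd measurable_into_borel] by auto
  have "(\<lambda>p. (fst p, snd p)) \<in> M \<Otimes>\<^sub>M M \<rightarrow>\<^sub>M (borel \<Otimes>\<^sub>M borel :: ('a \<times> 'a) measure)"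
    using f by (intro measurable_Pair)
  then have "(\<lambda>p. p) \<in> M \<Otimes>\<^sub>M M \<rightarrow>\<^sub>M (borel :: ('a \<times> 'a) measure)"
    by (simp add: borel_prod)
  then have "(\<lambda>p. p) \<in> M \<Otimes>\<^sub>M M \<rightarrow>\<^sub>M restrict_space borel (space M \<times> space M)"
    by (rule measurable_restrict_space2[rotated]) (simp add: space_pair_measure)
  moreover have "(\<lambda>(x, y). A x y) \<in> borel_measurable (restrict_space borel (space M \<times> space M))"
    using assms by (intro borel_measurable_continuous_on_restrict) (simp add: cont_kernel_def)
  ultimately show ?thesis by (rule measurable_compose)
qed

lemma cont_kernel_section_measurable:
  assumes "cont_kernel A" shows "A x \<in> borel_measurable M" "(\<lambda>x. A x y) \<in> borel_measurable M"
proof -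
  show "A x \<in> borel_measurable M"
  proof (cases "x \<in> space M")
    case True
    then show ?thesis
      using measurable_compose[OF measurable_Pair1' cont_kernel_measurable[OF assms], of x] by simp
  next
    case False
    then have "A x = (\<lambda>_. 0)" using cont_kernel_outside[OF assms] by auto
    then show ?thesis by simp
  qed
  show "(\<lambda>x. A x y) \<in> borel_measurable M"
  proof (cases "y \<in> space M")
    case True
    then show ?thesis
      using measurable_compose[OF measurable_Pair2' cont_kernel_measurable[OF assms], of y] by simp
  next
    case False
    then have "(\<lambda>x. A x y) = (\<lambda>_. 0)" using cont_kernel_outside[OF assms] by auto
    then show ?thesis by simp
  qed
qed

lemma cont_kernel_section_L2:
  assumes A: "cont_kernel A" shows "square_integrable M (A x)" "square_integrable M (\<lambda>x. A x y)"
proof -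
  obtain B where "\<And>x y. cmod (A x y) \<le> B" using cont_kernel_bounded[OF A] by metis
  then show "square_integrable M (A x)" "square_integrable M (\<lambda>x. A x y)"
    using square_integrable_bounded cont_kernel_section_measurable[OF A] by metis+
qed

lemma cont_kernel_diff: "cont_kernel A \<Longrightarrow> cont_kernel B \<Longrightarrow> cont_kernel (\<lambda>x y. A x y - B x y)"
  using continuous_on_diff[of "space M \<times> space M" "\<lambda>(x, y). A x y" "\<lambda>(x, y). B x y"]
  by (simp add: cont_kernel_def split_beta)

lemma cont_kernel_cmult: "cont_kernel A \<Longrightarrow> cont_kernel (\<lambda>x y. c * A x y)"
  using continuous_on_mult_left[of "space M \<times> space M" "\<lambda>(x, y). A x y" c]
  by (simp add: cont_kernel_def split_beta)

lemma cont_kernel_sum: "(\<And>i. i \<in> I \<Longrightarrow> cont_kernel (A i)) \<Longrightarrow> cont_kernel (\<lambda>x y. \<Sum>i\<in>I. A i x y)"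
  using continuous_on_sum[of I "space M \<times> space M" "\<lambda>i (x, y). A i x y"]
  by (simp add: cont_kernel_def split_beta)

lemma cont_kernel_comp:
  assumes A: "cont_kernel A" and B: "cont_kernel B"
  shows "cont_kernel (kernel_comp A B)"
proof -
  obtain a where a: "a \<ge> 0" "\<And>x y. cmod (A x y) \<le> a" using cont_kernel_bounded[OF A] by metis
  obtain b where b: "b \<ge> 0" "\<And>x y. cmod (B x y) \<le> b" using cont_kernel_bounded[OF B] by metis
  have "continuous_on (space M \<times> space M) (\<lambda>(x, y). kernel_comp A B x y)"
    unfolding continuous_on_sequentially
  proof safe
    fix p :: "nat \<Rightarrow> 'a \<times> 'a" and x y
    assume xy: "x \<in> space M" "y \<in> space M" and p: "\<forall>n. p n \<in> space M \<times> space M"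
      and lim: "p \<longlonglongrightarrow> (x, y)"
    have px: "(\<lambda>n. fst (p n)) \<longlonglongrightarrow> x" and py: "(\<lambda>n. snd (p n)) \<longlonglongrightarrow> y"
      using tendsto_fst[OF lim] tendsto_snd[OF lim] by simp_all
    have ps: "fst (p n) \<in> space M" "snd (p n) \<in> space M" for n
      using p by (metis mem_Times_iff)+
    have Alim: "(\<lambda>n. A (fst (p n)) \<xi>) \<longlonglongrightarrow> A x \<xi>" if "\<xi> \<in> space M" for \<xi>
      using continuous_on_tendsto_compose[of "space M \<times> space M" "\<lambda>(x, y). A x y",
          OF _ tendsto_Pair[OF px tendsto_const[of \<xi>]]]
        A that xy ps by (simp add: cont_kernel_def)
    have Blim: "(\<lambda>n. B \<xi> (snd (p n))) \<longlonglongrightarrow> B \<xi> y" if "\<xi> \<in> space M" for \<xi>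
      using continuous_on_tendsto_compose[of "space M \<times> space M" "\<lambda>(x, y). B x y",
          OF _ tendsto_Pair[OF tendsto_const[of \<xi>] py]]
        B that xy ps by (simp add: cont_kernel_def)
    have "(\<lambda>n. kernel_comp A B (fst (p n)) (snd (p n))) \<longlonglongrightarrow> kernel_comp A B x y"
      unfolding kernel_comp_def
    proof (rule integral_dominated_convergence[where w = "\<lambda>_. a * b"])
      show "(\<lambda>\<xi>. A x \<xi> * B \<xi> y) \<in> borel_measurable M"
        "\<And>n. (\<lambda>\<xi>. A (fst (p n)) \<xi> * B \<xi> (snd (p n))) \<in> borel_measurable M"
        using cont_kernel_section_measurable A B by (auto intro!: borel_measurable_times)
      show "AE \<xi> in M. (\<lambda>n. A (fst (p n)) \<xi> * B \<xi> (snd (p n))) \<longlonglongrightarrow> A x \<xi> * B \<xi> y"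
        using Alim Blim by (intro AE_I2 tendsto_mult)
      show "\<And>n. AE \<xi> in M. norm (A (fst (p n)) \<xi> * B \<xi> (snd (p n))) \<le> a * b"
        using a b by (auto simp: norm_mult intro!: mult_mono)
    qed simp
    then show "((\<lambda>(x, y). kernel_comp A B x y) \<circ> p) \<longlonglongrightarrow> kernel_comp A B x y"
      by (simp add: comp_def split_beta)
  qed
  moreover have "kernel_comp A B x y = 0" if "x \<notin> space M \<or> y \<notin> space M" for x y
    using that cont_kernel_outside[OF A] cont_kernel_outside[OF B] by (auto simp: kernel_comp_def)
  ultimately show ?thesis by (simp add: cont_kernel_def)
qed

lemma int_op_bound:
  assumes A: "cont_kernel A" and f: "square_integrable M f" and c: "\<And>y. cmod (A x y) \<le> c" "c \<ge> 0"
  shows "cmod (int_op A f x) \<le> c * sqrt (measure M (space M)) * sqrt (\<integral>y. (cmod (f y))\<^sup>2 \<partial>M)"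
proof -
  have "(\<integral>y. (cmod (A x y))\<^sup>2 \<partial>M) \<le> (\<integral>y. c\<^sup>2 \<partial>M)"
    using cont_kernel_section_L2(1)[OF A] c
    by (intro integral_mono) (auto simp: square_integrable_def intro!: power_mono)
  then have "sqrt (\<integral>y. (cmod (A x y))\<^sup>2 \<partial>M) \<le> c * sqrt (measure M (space M))"
    using real_sqrt_le_mono[of _ "measure M (space M) * c\<^sup>2"] c(2) by (simp add: real_sqrt_mult mult.commute)
  then have "sqrt (\<integral>y. (cmod (A x y))\<^sup>2 \<partial>M) * sqrt (\<integral>y. (cmod (f y))\<^sup>2 \<partial>M) \<le>
      c * sqrt (measure M (space M)) * sqrt (\<integral>y. (cmod (f y))\<^sup>2 \<partial>M)"
    by (intro mult_right_mono) auto
  with Cauchy_Schwarz_L2[OF cont_kernel_section_L2(1)[OF A] f, of x] show ?thesis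
    by (simp add: int_op_def)
qed

lemma int_op_measurable:
  assumes "(\<lambda>(x, y). A x y) \<in> borel_measurable (M \<Otimes>\<^sub>M M)" "f \<in> borel_measurable M"
  shows "int_op A f \<in> borel_measurable M"
proof -
  have [measurable]: "f \<in> borel_measurable M" "(\<lambda>p. A (fst p) (snd p)) \<in> borel_measurable (M \<Otimes>\<^sub>M M)"
    using assms by (simp_all add: split_beta)
  have "(\<lambda>x. \<integral>y. A x y * f y \<partial>M) \<in> borel_measurable M"
  proof (rule sigma_finite_measure.borel_measurable_lebesgue_integral)
    show "sigma_finite_measure M" by unfold_locales
    have "(\<lambda>p. A (fst p) (snd p) * f (snd p)) \<in> borel_measurable (M \<Otimes>\<^sub>M M)" by measurable
    then show "(\<lambda>(x, y). A x y * f y) \<in> borel_measurable (M \<Otimes>\<^sub>M M)" by (simp add: split_beta)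
  qed
  then show ?thesis by (simp add: int_op_def[abs_def])
qed

lemma int_op_L2:
  assumes A: "cont_kernel A" and f: "square_integrable M f"
  shows "square_integrable M (int_op A f)"
proof -
  obtain a where "a \<ge> 0" "\<And>x y. cmod (A x y) \<le> a" using cont_kernel_bounded[OF A] by metis
  then show ?thesis
    using int_op_bound[OF A f, of _ a] int_op_measurable[OF cont_kernel_measurable[OF A]] f
    by (intro square_integrable_bounded[where B = "a * sqrt (measure M (space M)) *
        sqrt (\<integral>y. (cmod (f y))\<^sup>2 \<partial>M)"]) (auto simp: square_integrable_def)
qed

lemma int_op_add:
  assumes A: "cont_kernel A" and f: "square_integrable M f" and g: "square_integrable M g"
  shows "int_op A (\<lambda>x. f x + g x) = (\<lambda>x. int_op A f x + int_op A g x)"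
  using square_integrable_mult[OF cont_kernel_section_L2(1)[OF A]] f g
  by (simp add: int_op_def fun_eq_iff distrib_left)

lemma int_op_diff:
  assumes A: "cont_kernel A" and f: "square_integrable M f" and g: "square_integrable M g"
  shows "int_op A (\<lambda>x. f x - g x) = (\<lambda>x. int_op A f x - int_op A g x)"
  using square_integrable_mult[OF cont_kernel_section_L2(1)[OF A]] f g
  by (simp add: int_op_def fun_eq_iff right_diff_distrib)

lemma int_op_cmult: "int_op A (\<lambda>x. c * f x) = (\<lambda>x. c * int_op A f x)"
proof
  fix x
  have "int_op A (\<lambda>x. c * f x) x = (\<integral>y. c * (A x y * f y) \<partial>M)"
    unfolding int_op_def by (intro Bochner_Integration.integral_cong) (auto simp: mult_ac)
  then show "int_op A (\<lambda>x. c * f x) x = c * int_op A f x"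
    by (simp add: int_op_def)
qed

lemma int_op_kernel_diff:
  assumes "cont_kernel A" "cont_kernel B" "square_integrable M f"
  shows "int_op (\<lambda>x y. A x y - B x y) f = (\<lambda>x. int_op A f x - int_op B f x)"
  using square_integrable_mult[OF cont_kernel_section_L2(1) assms(3)] assms
  by (simp add: int_op_def fun_eq_iff left_diff_distrib)

lemma int_op_kernel_sum:
  assumes "\<And>i. i \<in> I \<Longrightarrow> cont_kernel (A i)" "square_integrable M f"
  shows "int_op (\<lambda>x y. \<Sum>i\<in>I. c i * A i x y) f x = (\<Sum>i\<in>I. c i * int_op (A i) f x)"
proof -
  have "integrable M (\<lambda>y. c i * (A i x y * f y))" if "i \<in> I" for i
    using square_integrable_mult[OF cont_kernel_section_L2(1)[OF assms(1)[OF that]] assms(2)] by simp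
  then show ?thesis
    by (simp add: int_op_def sum_distrib_right mult.assoc)
qed

text \<open>
  By Fubini's theorem the composition of kernels is the composition of operators. Applied to the
  functions \<open>C(\<cdot>, y)\<close>, this also yields associativity of the composition of kernels.
\<close>

lemma int_op_comp:
  assumes A: "cont_kernel A" and B: "cont_kernel B" and f: "square_integrable M f"
  shows "int_op (kernel_comp A B) f = int_op A (int_op B f)"
proof
  fix x
  obtain a where a: "a \<ge> 0" "\<And>x y. cmod (A x y) \<le> a" using cont_kernel_bounded[OF A] by metis
  obtain b where b: "b \<ge> 0" "\<And>x y. cmod (B x y) \<le> b" using cont_kernel_bounded[OF B] by metis
  have [measurable]: "f \<in> borel_measurable M" "A x \<in> borel_measurable M"
    "(\<lambda>p. B (fst p) (snd p)) \<in> borel_measurable (M \<Otimes>\<^sub>M M)"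
    using f cont_kernel_section_measurable[OF A] cont_kernel_measurable[OF B]
    by (simp_all add: square_integrable_def split_beta)
  have fi: "integrable M (\<lambda>y. cmod (f y))"
    using square_integrable_integrable[OF f] by simp
  have dom: "integrable (M \<Otimes>\<^sub>M M) (\<lambda>p. a * b * cmod (f (snd p)))"
    by (rule Fubini_integrable) (use fi in simp_all)
  have int: "integrable (M \<Otimes>\<^sub>M M) (\<lambda>(\<xi>, y). A x \<xi> * B \<xi> y * f y)"
    unfolding split_beta
  proof (rule Bochner_Integration.integrable_bound[OF dom])
    show "AE p in M \<Otimes>\<^sub>M M. norm (A x (fst p) * B (fst p) (snd p) * f (snd p)) \<le>
        norm (a * b * cmod (f (snd p)))"
      using a b by (auto simp: norm_mult intro!: mult_mono)
  qed measurable
  have "int_op (kernel_comp A B) f x = (\<integral>y. (\<integral>\<xi>. A x \<xi> * B \<xi> y * f y \<partial>M) \<partial>M)"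
    by (simp add: int_op_def kernel_comp_def)
  also have "\<dots> = (\<integral>\<xi>. (\<integral>y. A x \<xi> * B \<xi> y * f y \<partial>M) \<partial>M)"
    by (rule Fubini_integral[OF int])
  also have "\<dots> = int_op A (int_op B f) x"
    by (simp add: int_op_def mult.assoc)
  finally show "int_op (kernel_comp A B) f x = int_op A (int_op B f) x" .
qed

lemma kernel_comp_assoc:
  assumes "cont_kernel A" "cont_kernel B" "cont_kernel C"
  shows "kernel_comp (kernel_comp A B) C = kernel_comp A (kernel_comp B C)"
proof (intro ext)
  fix x y
  have "kernel_comp (kernel_comp A B) C x y = int_op (kernel_comp A B) (\<lambda>\<xi>. C \<xi> y) x"
    by (rule kernel_comp_int_op)
  also have "\<dots> = int_op A (int_op B (\<lambda>\<xi>. C \<xi> y)) x"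
    using assms by (simp add: int_op_comp cont_kernel_section_L2(2))
  finally show "kernel_comp (kernel_comp A B) C x y = kernel_comp A (kernel_comp B C) x y"
    by (simp add: kernel_comp_int_op[abs_def])
qed

lemma kernel_comp_diff_left:
  assumes "cont_kernel A" "cont_kernel B" "cont_kernel C"
  shows "kernel_comp (\<lambda>x y. A x y - B x y) C = (\<lambda>x y. kernel_comp A C x y - kernel_comp B C x y)"
  using assms by (simp add: kernel_comp_int_op fun_eq_iff int_op_kernel_diff cont_kernel_section_L2)

lemma inner_L2_add_left:
  "square_integrable M f \<Longrightarrow> square_integrable M g \<Longrightarrow> square_integrable M h \<Longrightarrow>
    inner_L2 (\<lambda>x. f x + g x) h = inner_L2 f h + inner_L2 g h"
  by (simp add: inner_L2_def distrib_right square_integrable_mult square_integrable_cnj)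

lemma inner_L2_diff_left:
  "square_integrable M f \<Longrightarrow> square_integrable M g \<Longrightarrow> square_integrable M h \<Longrightarrow>
    inner_L2 (\<lambda>x. f x - g x) h = inner_L2 f h - inner_L2 g h"
  by (simp add: inner_L2_def left_diff_distrib square_integrable_mult square_integrable_cnj)

lemma inner_L2_commute: "inner_L2 g f = cnj (inner_L2 f g)"
proof -
  have "cnj (inner_L2 f g) = (\<integral>x. cnj (f x * cnj (g x)) \<partial>M)"
    by (simp only: inner_L2_def Bochner_Integration.integral_cnj)
  then show ?thesis
    by (simp add: inner_L2_def mult.commute del: Bochner_Integration.integral_cnj)
qed

lemma inner_L2_add_right:
  "square_integrable M f \<Longrightarrow> square_integrable M g \<Longrightarrow> square_integrable M h \<Longrightarrow>
    inner_L2 h (\<lambda>x. f x + g x) = inner_L2 h f + inner_L2 h g"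
  by (metis inner_L2_add_left inner_L2_commute complex_cnj_add)

lemma inner_L2_diff_right:
  "square_integrable M f \<Longrightarrow> square_integrable M g \<Longrightarrow> square_integrable M h \<Longrightarrow>
    inner_L2 h (\<lambda>x. f x - g x) = inner_L2 h f - inner_L2 h g"
  by (metis inner_L2_diff_left inner_L2_commute complex_cnj_diff)

lemma inner_L2_cmult_left: "inner_L2 (\<lambda>x. c * f x) g = c * inner_L2 f g"
  by (simp add: inner_L2_def mult.assoc)

lemma inner_L2_cmult_right: "inner_L2 f (\<lambda>x. c * g x) = cnj c * inner_L2 f g"
  by (metis inner_L2_cmult_left inner_L2_commute complex_cnj_mult)

lemma inner_L2_self: "inner_L2 f f = of_real (\<integral>x. (cmod (f x))\<^sup>2 \<partial>M)"
proof -
  have "inner_L2 f f = (\<integral>x. complex_of_real ((cmod (f x))\<^sup>2) \<partial>M)"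
    by (simp only: inner_L2_def complex_norm_square)
  then show ?thesis by (simp only: integral_complex_of_real)
qed

lemma inner_L2_sum_left:
  assumes "\<And>i. i \<in> I \<Longrightarrow> square_integrable M (f i)" "square_integrable M g"
  shows "inner_L2 (\<lambda>x. \<Sum>i\<in>I. c i * f i x) g = (\<Sum>i\<in>I. c i * inner_L2 (f i) g)"
proof -
  have "integrable M (\<lambda>x. c i * (f i x * cnj (g x)))" if "i \<in> I" for i
    using square_integrable_mult[OF assms(1)[OF that] square_integrable_cnj[OF assms(2)]] by simp
  then show ?thesis
    by (simp add: inner_L2_def sum_distrib_right mult.assoc)
qed

lemma inner_L2_bound:
  assumes "square_integrable M f" "square_integrable M g"
  shows "cmod (inner_L2 f g) \<le> sqrt (\<integral>x. (cmod (f x))\<^sup>2 \<partial>M) * sqrt (\<integral>x. (cmod (g x))\<^sup>2 \<partial>M)"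
  using Cauchy_Schwarz_L2[OF assms(1) square_integrable_cnj[OF assms(2)]] by (simp add: inner_L2_def)

text \<open>
  Normalised indicator functions of shrinking balls: an approximation of the point mass at \<open>x\<close> within
  \<open>L\<^sup>2\<close>, through which the values of a continuous kernel are recovered from its operator.
\<close>

definition cap :: "'a \<Rightarrow> nat \<Rightarrow> 'a \<Rightarrow> complex" where
  "cap x n y = of_real (indicator (ball x (1 / real (Suc n)) \<inter> space M) y /
     measure M (ball x (1 / real (Suc n)) \<inter> space M))"

lemma cap_L2: "square_integrable M (cap x n)"
proof (rule square_integrable_bounded)
  have "ball x (1 / real (Suc n)) \<inter> space M \<in> sets M"
    unfolding sets_eq_borel by (auto simp: sets_restrict_space)
  then show "cap x n \<in> borel_measurable M"
    unfolding cap_def[abs_def] by measurable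
  show "cmod (cap x n y) \<le> 1 / measure M (ball x (1 / real (Suc n)) \<inter> space M)" for y
    by (auto simp: cap_def norm_divide split: split_indicator)
qed

lemma cap_average:
  assumes x: "x \<in> space M" and h: "square_integrable M h"
    and e: "\<And>y. y \<in> space M \<Longrightarrow> dist x y < 1 / real (Suc n) \<Longrightarrow> cmod (h y - c) \<le> \<epsilon>"
  shows "cmod ((\<integral>y. h y * cap x n y \<partial>M) - c) \<le> \<epsilon>"
proof -
  let ?U = "ball x (1 / real (Suc n)) \<inter> space M"
  have U: "?U \<in> sets M"
    unfolding sets_eq_borel by (auto simp: sets_restrict_space)
  have "x \<in> ?U" using x by simp
  then have "emeasure M ?U > 0"
    using open_pos[OF open_ball] by blast
  then have pos: "measure M ?U > 0"
    by (simp add: emeasure_eq_measure)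
  note i1 = square_integrable_mult[OF h cap_L2[of x n]]
  have ci: "integrable M (cap x n)" by (rule square_integrable_integrable[OF cap_L2])
  have one: "(\<integral>y. cap x n y \<partial>M) = 1"
  proof -
    have "(\<integral>y. cap x n y \<partial>M) = of_real (\<integral>y. indicator ?U y / measure M ?U \<partial>M)"
      unfolding cap_def by (rule integral_complex_of_real)
    also have "(\<integral>y. indicator ?U y / measure M ?U \<partial>M) = 1"
      using pos U by simp
    finally show ?thesis by simp
  qed
  have n1: "(\<integral>y. \<epsilon> * cmod (cap x n y) \<partial>M) = \<epsilon>"
  proof -
    have "(\<integral>y. \<epsilon> * cmod (cap x n y) \<partial>M) = (\<integral>y. \<epsilon> * (indicator ?U y / measure M ?U) \<partial>M)"
      using pos by (intro Bochner_Integration.integral_cong) (auto simp: cap_def norm_divide split: split_indicator)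
    then show ?thesis
      using pos U by simp
  qed
  have "(\<integral>y. h y * cap x n y \<partial>M) - c = (\<integral>y. h y * cap x n y - c * cap x n y \<partial>M)"
    using i1 ci one by simp
  also have "\<dots> = (\<integral>y. (h y - c) * cap x n y \<partial>M)"
    by (simp add: left_diff_distrib)
  also have "cmod \<dots> \<le> (\<integral>y. cmod ((h y - c) * cap x n y) \<partial>M)"
    by (rule integral_norm_bound)
  also have "\<dots> \<le> (\<integral>y. \<epsilon> * cmod (cap x n y) \<partial>M)"
  proof (rule integral_mono)
    show "integrable M (\<lambda>y. cmod ((h y - c) * cap x n y))"
      using i1 ci by (intro integrable_norm) (simp add: left_diff_distrib)
    show "integrable M (\<lambda>y. \<epsilon> * cmod (cap x n y))" using ci by simp
    fix y assume y: "y \<in> space M"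
    show "cmod ((h y - c) * cap x n y) \<le> \<epsilon> * cmod (cap x n y)"
    proof (cases "dist x y < 1 / real (Suc n)")
      case True
      show ?thesis
        unfolding norm_mult by (rule mult_right_mono[OF e[OF y True]]) simp
    next
      case False
      then show ?thesis by (simp add: cap_def)
    qed
  qed
  finally show ?thesis unfolding n1 .
qed

lemma cap_limit:
  assumes A: "cont_kernel A" and x: "x \<in> space M" and y: "y \<in> space M"
  shows "(\<lambda>n. inner_L2 (int_op A (cap y n)) (cap x n)) \<longlonglongrightarrow> A x y"
proof (rule LIMSEQ_I)
  fix r :: real assume "r > 0"
  have "continuous_on (space M \<times> space M) (\<lambda>(x, y). A x y)"
    using A by (simp add: cont_kernel_def)
  then obtain d where "d > 0" and
    d: "\<And>x' y'. x' \<in> space M \<Longrightarrow> y' \<in> space M \<Longrightarrow> dist (x', y') (x, y) < d \<Longrightarrow> dist (A x' y') (A x y) < r / 2"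
    using continuous_on_iff[of "space M \<times> space M" "\<lambda>(x, y). A x y"] x y half_gt_zero[OF \<open>r > 0\<close>]
    by (metis (mono_tags, lifting) case_prod_conv mem_Sigma_iff)
  obtain N where N: "1 / real (Suc N) < d / 2"
    using \<open>d > 0\<close> reals_Archimedean[of "d / 2"] by (auto simp: inverse_eq_divide)
  have "norm (inner_L2 (int_op A (cap y n)) (cap x n) - A x y) < r" if "n \<ge> N" for n
  proof -
    have "1 / real (Suc n) \<le> 1 / real (Suc N)" using that by (simp add: frac_le)
    with N have n: "1 / real (Suc n) < d / 2" by simp
    have near: "cmod (A x' y' - A x y) \<le> r / 2"
      if "x' \<in> space M" "y' \<in> space M" "dist x x' < 1 / real (Suc n)" "dist y y' < 1 / real (Suc n)" for x' y'
    proof -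
      have "dist (x', y') (x, y) \<le> dist x' x + dist y' y"
        unfolding dist_Pair_Pair by (rule sqrt_sum_squares_le_sum) auto
      also have "\<dots> < d" using that n by (simp add: dist_commute)
      finally show ?thesis using d[OF that(1,2)] by (simp add: dist_norm)
    qed
    have "cmod (int_op A (cap y n) x' - A x y) \<le> r / 2" if "x' \<in> space M" "dist x x' < 1 / real (Suc n)" for x'
      unfolding int_op_def using near that cont_kernel_section_L2(1)[OF A] by (intro cap_average[OF y]) auto
    then have "cmod ((\<integral>x'. int_op A (cap y n) x' * cap x n x' \<partial>M) - A x y) \<le> r / 2"
      by (intro cap_average[OF x] int_op_L2[OF A] cap_L2)
    moreover have "inner_L2 (int_op A (cap y n)) (cap x n) = (\<integral>x'. int_op A (cap y n) x' * cap x n x' \<partial>M)"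
      by (simp add: inner_L2_def cap_def)
    ultimately show ?thesis using \<open>r > 0\<close> by simp
  qed
  then show "\<exists>N. \<forall>n\<ge>N. norm (inner_L2 (int_op A (cap y n)) (cap x n) - A x y) < r" by blast
qed

lemma pos_kernel_diagonal:
  assumes A: "cont_kernel A" and "pos_kernel A" shows "A x x \<in> nonneg_Reals"
proof (cases "x \<in> space M")
  case True
  show ?thesis
    by (rule closed_sequentially[OF closed_nonneg_Reals_complex _ cap_limit[OF A True True]])
       (use assms cap_L2 in \<open>auto simp: pos_kernel_def\<close>)
next
  case False
  then show ?thesis by (simp add: cont_kernel_outside[OF A])
qed

end

section \<open>Functional calculus for a contractive positive kernel\<close>

lemma nonneg_Reals_sum: "(\<And>i. i \<in> I \<Longrightarrow> f i \<in> nonneg_Reals) \<Longrightarrow> (\<Sum>i\<in>I. f i :: complex) \<in> nonneg_Reals"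
  by (induction I rule: infinite_finite_induct) auto

text \<open>
  The bound on \<open>K\<close> is the simplest one that forces \<open>T \<le> I\<close>.
\<close>

locale contractive_positive_kernel = compact_measure_space M
  for M :: "'a :: {metric_space, second_countable_topology} measure" +
  fixes K :: "'a \<Rightarrow> 'a \<Rightarrow> complex"
  assumes K_cont: "cont_kernel K"
    and K_pos: "pos_kernel K"
    and K_bound: "\<And>x y. cmod (K x y) \<le> 1 / measure M (space M)"
begin

abbreviation T :: "('a \<Rightarrow> complex) \<Rightarrow> 'a \<Rightarrow> complex" where
  "T \<equiv> int_op K"

definition id_minus_T :: "('a \<Rightarrow> complex) \<Rightarrow> 'a \<Rightarrow> complex" where
  "id_minus_T f = (\<lambda>x. f x - T f x)"

lemma T_L2: "square_integrable M f \<Longrightarrow> square_integrable M (T f)"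
  by (rule int_op_L2[OF K_cont])

lemma id_minus_T_L2: "square_integrable M f \<Longrightarrow> square_integrable M (id_minus_T f)"
  unfolding id_minus_T_def by (intro square_integrable_diff T_L2)

lemma id_minus_T_pow_L2: "square_integrable M f \<Longrightarrow> square_integrable M ((id_minus_T ^^ k) f)"
  by (induction k) (simp_all add: id_minus_T_L2)

lemma T_id_minus_T_commute: "square_integrable M f \<Longrightarrow> T (id_minus_T f) = id_minus_T (T f)"
  by (simp add: id_minus_T_def int_op_diff[OF K_cont] T_L2)

lemma T_quadratic_real:
  "square_integrable M f \<Longrightarrow> Im (inner_L2 (T f) f) = 0 \<and> Re (inner_L2 (T f) f) \<ge> 0"
  using K_pos by (simp add: pos_kernel_def complex_nonneg_Reals_iff)

text \<open>
  A complex operator with real quadratic form is symmetric, by polarization with \<open>f + g\<close> and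
  \<open>f + \<i> g\<close>.
\<close>

lemma T_symmetric:
  assumes f: "square_integrable M f" and g: "square_integrable M g"
  shows "inner_L2 (T f) g = inner_L2 f (T g)"
proof -
  let ?a = "inner_L2 (T f) g" and ?b = "inner_L2 (T g) f"
  note ig = square_integrable_cmult[OF g, of \<i>]
  have "inner_L2 (T (\<lambda>x. f x + g x)) (\<lambda>x. f x + g x) =
      inner_L2 (T f) f + ?a + ?b + inner_L2 (T g) g"
    by (simp add: int_op_add[OF K_cont f g] inner_L2_add_left inner_L2_add_right
        square_integrable_add T_L2 f g)
  then have 1: "Im ?a + Im ?b = 0"
    using T_quadratic_real[OF f] T_quadratic_real[OF g] T_quadratic_real[OF square_integrable_add[OF f g]]
    by simp
  have "inner_L2 (T (\<lambda>x. f x + \<i> * g x)) (\<lambda>x. f x + \<i> * g x) =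
      inner_L2 (T f) f - \<i> * ?a + \<i> * ?b + inner_L2 (T g) g"
    by (simp add: int_op_add[OF K_cont f ig] int_op_cmult inner_L2_add_left inner_L2_add_right
        inner_L2_cmult_left inner_L2_cmult_right square_integrable_add square_integrable_cmult T_L2 f g algebra_simps)
  then have 2: "Re ?b - Re ?a = 0"
    using T_quadratic_real[OF f] T_quadratic_real[OF g] T_quadratic_real[OF square_integrable_add[OF f ig]]
    by simp
  have "?a = cnj ?b"
    using 1 2 by (simp add: complex_eq_iff)
  then show ?thesis
    using inner_L2_commute[of f "T g"] by simp
qed

lemma id_minus_T_symmetric:
  assumes "square_integrable M f" "square_integrable M g"
  shows "inner_L2 (id_minus_T f) g = inner_L2 f (id_minus_T g)"
  using assms by (simp add: id_minus_T_def inner_L2_diff_left inner_L2_diff_right T_L2 T_symmetric)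

text \<open>
  The Cauchy--Schwarz inequality bounds \<open>\<bar>T f(x)\<bar>\<^sup>2\<close> by \<open>\<parallel>f\<parallel>\<^sup>2 / m\<close> at every point, where \<open>m\<close> is the total
  mass; integrating over \<open>x\<close> cancels \<open>m\<close>.
\<close>

lemma T_contraction:
  assumes f: "square_integrable M f"
  shows "(\<integral>x. (cmod (T f x))\<^sup>2 \<partial>M) \<le> (\<integral>x. (cmod (f x))\<^sup>2 \<partial>M)"
proof -
  let ?m = "measure M (space M)" and ?N = "\<integral>x. (cmod (f x))\<^sup>2 \<partial>M"
  have "(cmod (T f x))\<^sup>2 \<le> ?N / ?m" for x
  proof -
    have "cmod (T f x) \<le> 1 / ?m * sqrt ?m * sqrt ?N"
      by (rule int_op_bound[OF K_cont f K_bound]) simp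
    then have "(cmod (T f x))\<^sup>2 \<le> (1 / ?m * sqrt ?m * sqrt ?N)\<^sup>2"
      by (rule power_mono) simp
    also have "\<dots> = ?N / ?m"
      by (simp add: power_mult_distrib power_divide) (simp add: power2_eq_square)
    finally show ?thesis .
  qed
  then have "(\<integral>x. (cmod (T f x))\<^sup>2 \<partial>M) \<le> (\<integral>x. ?N / ?m \<partial>M)"
    using T_L2[OF f] by (intro integral_mono) (auto simp: square_integrable_def)
  also have "\<dots> \<le> ?N" by simp
  finally show ?thesis .
qed

lemma id_minus_T_positive:
  assumes f: "square_integrable M f" shows "inner_L2 (id_minus_T f) f \<in> nonneg_Reals"
proof -
  let ?N = "\<integral>x. (cmod (f x))\<^sup>2 \<partial>M"
  have "cmod (inner_L2 (T f) f) \<le> sqrt (\<integral>x. (cmod (T f x))\<^sup>2 \<partial>M) * sqrt ?N"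
    by (rule inner_L2_bound[OF T_L2[OF f] f])
  also have "\<dots> \<le> sqrt ?N * sqrt ?N"
    by (intro mult_right_mono real_sqrt_le_mono T_contraction f) simp
  also have "\<dots> = ?N" by simp
  finally have "Re (inner_L2 (T f) f) \<le> ?N"
    using complex_Re_le_cmod order_trans by blast
  then show ?thesis
    using T_quadratic_real[OF f] f
    by (simp add: id_minus_T_def inner_L2_diff_left T_L2 complex_nonneg_Reals_iff inner_L2_self)
qed

text \<open>
  Symmetry moves one factor \<open>I - T\<close> to the other side, which lowers the exponent by two; the
  exponents \<open>0\<close> and \<open>1\<close> remain.
\<close>

lemma id_minus_T_pow_positive:
  assumes "square_integrable M f" shows "inner_L2 ((id_minus_T ^^ k) f) f \<in> nonneg_Reals"
  using assms
proof (induction k arbitrary: f rule: nat_induct2)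
  case (0 f)
  show ?case by (simp add: inner_L2_self)
next
  case (1 f)
  then show ?case by (simp add: id_minus_T_positive)
next
  case (step k f)
  have "(id_minus_T ^^ (k + 2)) f = id_minus_T ((id_minus_T ^^ k) (id_minus_T f))"
    by (simp add: funpow_swap1)
  then have "inner_L2 ((id_minus_T ^^ (k + 2)) f) f = inner_L2 ((id_minus_T ^^ k) (id_minus_T f)) (id_minus_T f)"
    using step by (simp add: id_minus_T_symmetric id_minus_T_pow_L2 id_minus_T_L2)
  then show ?case using step by (simp add: id_minus_T_L2)
qed

text \<open>
  The same descent as for the powers of \<open>I - T\<close>. The exponent \<open>1\<close> needs positivity of \<open>T (I - T)\<close>, which
  follows from \<open>T (I - T) = (I - T) T (I - T) + T (I - T) T\<close>.
\<close>

lemma id_minus_T_pow_T_positive: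
  assumes "square_integrable M f" shows "inner_L2 ((id_minus_T ^^ k) (T f)) f \<in> nonneg_Reals"
  using assms
proof (induction k arbitrary: f rule: nat_induct2)
  case (0 f)
  then show ?case using K_pos by (simp add: pos_kernel_def)
next
  case (1 f)
  have "inner_L2 (id_minus_T (T f)) f = inner_L2 (id_minus_T (T f)) (\<lambda>x. id_minus_T f x + T f x)"
    by (simp add: id_minus_T_def)
  also have "\<dots> = inner_L2 (T (id_minus_T f)) (id_minus_T f) + inner_L2 (id_minus_T (T f)) (T f)"
    using 1 by (simp only: inner_L2_add_right id_minus_T_L2 T_L2 T_id_minus_T_commute)
  finally show ?case
    using K_pos id_minus_T_positive[OF T_L2[OF 1]] id_minus_T_L2[OF 1] by (simp add: pos_kernel_def)
next
  case (step k f)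
  have "(id_minus_T ^^ (k + 2)) (T f) = id_minus_T ((id_minus_T ^^ k) (T (id_minus_T f)))"
    using step by (simp add: funpow_swap1 T_id_minus_T_commute)
  then have "inner_L2 ((id_minus_T ^^ (k + 2)) (T f)) f = inner_L2 ((id_minus_T ^^ k) (T (id_minus_T f))) (id_minus_T f)"
    using step by (simp add: id_minus_T_symmetric id_minus_T_pow_L2 id_minus_T_L2 T_L2)
  then show ?case using step by (simp add: id_minus_T_L2)
qed

text \<open>
  The kernel of \<open>T (I - T)\<^sup>k\<close>.
\<close>

primrec basis_kernel :: "nat \<Rightarrow> 'a \<Rightarrow> 'a \<Rightarrow> complex" where
  "basis_kernel 0 = K"
| "basis_kernel (Suc k) = (\<lambda>x y. basis_kernel k x y - kernel_comp K (basis_kernel k) x y)"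

text \<open>
  The kernel of \<open>T p(I - T)\<close>. The factor \<open>T\<close> is what makes this an integral operator, and it also
  accounts for the additional factor in \<open>kernel_comp_poly_kernel\<close> below.
\<close>

definition poly_kernel :: "real poly \<Rightarrow> 'a \<Rightarrow> 'a \<Rightarrow> complex" where
  "poly_kernel p x y = (\<Sum>k\<le>degree p. of_real (coeff p k) * basis_kernel k x y)"

lemma basis_kernel_cont: "cont_kernel (basis_kernel k)"
  by (induction k) (simp_all add: K_cont cont_kernel_diff cont_kernel_comp)

lemma int_op_pow_kernel: "square_integrable M f \<Longrightarrow> int_op (basis_kernel k) f = (id_minus_T ^^ k) (T f)"
  by (induction k)
    (simp_all add: int_op_kernel_diff basis_kernel_cont cont_kernel_comp K_cont int_op_comp id_minus_T_def)

lemma poly_kernel_cont: "cont_kernel (poly_kernel p)"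
  unfolding poly_kernel_def[abs_def] by (intro cont_kernel_sum cont_kernel_cmult basis_kernel_cont)

lemma poly_kernel_eq:
  "degree p \<le> n \<Longrightarrow> poly_kernel p x y = (\<Sum>k\<le>n. of_real (coeff p k) * basis_kernel k x y)"
  unfolding poly_kernel_def by (rule sum.mono_neutral_left) (auto simp: coeff_eq_0)

lemma poly_kernel_0: "poly_kernel 0 = (\<lambda>x y. 0)"
  by (simp add: poly_kernel_def fun_eq_iff)

lemma poly_kernel_1: "poly_kernel 1 = K"
  by (simp add: poly_kernel_def fun_eq_iff)

lemma poly_kernel_const: "poly_kernel [:a:] = (\<lambda>x y. of_real a * K x y)"
  by (simp add: poly_kernel_def fun_eq_iff)

lemma poly_kernel_smult: "poly_kernel (smult a p) = (\<lambda>x y. of_real a * poly_kernel p x y)"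
  by (simp add: poly_kernel_def fun_eq_iff sum_distrib_left mult.assoc)

lemma poly_kernel_add: "poly_kernel (p + r) = (\<lambda>x y. poly_kernel p x y + poly_kernel r x y)"
proof (intro ext)
  fix x y
  define n where "n = max (degree p) (degree r)"
  have "degree (p + r) \<le> n" "degree p \<le> n" "degree r \<le> n"
    by (auto simp: n_def degree_add_le)
  then show "poly_kernel (p + r) x y = poly_kernel p x y + poly_kernel r x y"
    by (simp add: poly_kernel_eq[of _ n] sum.distrib distrib_right)
qed

lemma poly_kernel_diff: "poly_kernel (p - r) = (\<lambda>x y. poly_kernel p x y - poly_kernel r x y)"
  using poly_kernel_add[of p "smult (-1) r"] by (simp only: poly_kernel_smult) simp

lemma poly_kernel_pCons_0:
  "poly_kernel (pCons 0 p) x y = (\<Sum>k\<le>degree p. of_real (coeff p k) * basis_kernel (Suc k) x y)"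
proof -
  have "degree (pCons 0 p) \<le> Suc (degree p)" by (rule degree_pCons_le)
  then show ?thesis
    by (simp add: poly_kernel_eq[of _ "Suc (degree p)"] sum.atMost_Suc_shift
        del: sum.atMost_Suc basis_kernel.simps)
qed

lemma kernel_comp_K_poly_kernel: "kernel_comp K (poly_kernel p) = poly_kernel (one_minus_X * p)"
proof (intro ext)
  fix x y
  have "kernel_comp K (poly_kernel p) x y =
      (\<Sum>k\<le>degree p. of_real (coeff p k) * kernel_comp K (basis_kernel k) x y)"
  proof -
    have "integrable M (\<lambda>\<xi>. of_real (coeff p k) * (K x \<xi> * basis_kernel k \<xi> y))" for k
      by (intro integrable_mult_right square_integrable_mult cont_kernel_section_L2 K_cont basis_kernel_cont)
    then have "(\<integral>\<xi>. (\<Sum>k\<le>degree p. of_real (coeff p k) * (K x \<xi> * basis_kernel k \<xi> y)) \<partial>M) =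
        (\<Sum>k\<le>degree p. of_real (coeff p k) * kernel_comp K (basis_kernel k) x y)"
      by (subst Bochner_Integration.integral_sum) (simp_all add: kernel_comp_def)
    then show ?thesis
      by (simp add: kernel_comp_def poly_kernel_def sum_distrib_left mult.left_commute)
  qed
  also have "\<dots> = poly_kernel p x y - poly_kernel (pCons 0 p) x y"
    by (simp add: poly_kernel_pCons_0 poly_kernel_def[of p] sum_subtractf[symmetric] right_diff_distrib)
  also have "\<dots> = poly_kernel (one_minus_X * p) x y"
    using poly_kernel_diff[of p "pCons 0 p"] pCons_0_one_minus_X[of p] by (simp add: fun_eq_iff)
  finally show "kernel_comp K (poly_kernel p) x y = poly_kernel (one_minus_X * p) x y" .
qed

lemma kernel_comp_poly_kernel:
  "kernel_comp (poly_kernel p) (poly_kernel r) = poly_kernel (one_minus_X * (p * r))"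
proof (induction p)
  case 0
  then show ?case by (simp add: poly_kernel_0 kernel_comp_def fun_eq_iff)
next
  case (pCons a p)
  have e: "poly_kernel (pCons 0 p) = (\<lambda>x y. poly_kernel p x y - kernel_comp K (poly_kernel p) x y)"
    unfolding kernel_comp_K_poly_kernel poly_kernel_diff[symmetric] pCons_0_one_minus_X[of p] ..
  have 0: "kernel_comp (poly_kernel (pCons 0 p)) (poly_kernel r) = poly_kernel (one_minus_X * (pCons 0 p * r))"
  proof -
    have "kernel_comp (poly_kernel (pCons 0 p)) (poly_kernel r) =
        poly_kernel (one_minus_X * (p * r) - one_minus_X * (one_minus_X * (p * r)))"
    proof -
      have "kernel_comp (kernel_comp K (poly_kernel p)) (poly_kernel r) =
          poly_kernel (one_minus_X * (one_minus_X * (p * r)))"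
        by (subst kernel_comp_assoc[OF K_cont poly_kernel_cont poly_kernel_cont])
          (simp only: pCons.IH kernel_comp_K_poly_kernel)
      then show ?thesis
        unfolding e kernel_comp_diff_left[OF poly_kernel_cont
            cont_kernel_comp[OF K_cont poly_kernel_cont] poly_kernel_cont]
        by (simp only: pCons.IH poly_kernel_diff)
    qed
    also have "one_minus_X * (p * r) - one_minus_X * (one_minus_X * (p * r)) = one_minus_X * (pCons 0 p * r)"
      unfolding pCons_0_one_minus_X by (simp add: algebra_simps)
    finally show ?thesis .
  qed
  have a: "poly_kernel (pCons a p) = (\<lambda>x y. poly_kernel (pCons 0 p) x y - of_real (- a) * K x y)"
    using poly_kernel_diff[of "pCons 0 p" "[:- a:]"]
    by (simp add: poly_kernel_const)
  have c: "kernel_comp (\<lambda>x y. of_real (- a) * K x y) (poly_kernel r) =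
      poly_kernel (smult (- a) (one_minus_X * r))"
    unfolding poly_kernel_smult kernel_comp_K_poly_kernel[symmetric]
    by (simp add: kernel_comp_def fun_eq_iff mult.assoc)
  have "kernel_comp (poly_kernel (pCons a p)) (poly_kernel r) =
      poly_kernel (one_minus_X * (pCons 0 p * r) - smult (- a) (one_minus_X * r))"
    unfolding a kernel_comp_diff_left[OF poly_kernel_cont cont_kernel_cmult[OF K_cont] poly_kernel_cont]
      0 c poly_kernel_diff ..
  also have "one_minus_X * (pCons 0 p * r) - smult (- a) (one_minus_X * r) = one_minus_X * (pCons a p * r)"
    by (simp add: algebra_simps)
  finally show ?case .
qed

lemma inner_L2_poly_kernel:
  assumes f: "square_integrable M f" and g: "square_integrable M g"
  shows "inner_L2 (int_op (poly_kernel p) f) g =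
    (\<Sum>k\<le>degree p. of_real (coeff p k) * inner_L2 ((id_minus_T ^^ k) (T f)) g)"
proof -
  have "int_op (poly_kernel p) f = (\<lambda>x. \<Sum>k\<le>degree p. of_real (coeff p k) * (id_minus_T ^^ k) (T f) x)"
    unfolding poly_kernel_def[abs_def] using f
    by (simp add: fun_eq_iff int_op_kernel_sum basis_kernel_cont int_op_pow_kernel)
  then show ?thesis
    using g by (simp add: inner_L2_sum_left id_minus_T_pow_L2 T_L2 f)
qed

lemma poly_kernel_pos:
  assumes "nonneg_coeffs p" shows "pos_kernel (poly_kernel p)"
  unfolding pos_kernel_def
  using assms by (auto simp: inner_L2_poly_kernel nonneg_coeffs_def intro!: nonneg_Reals_sum
      nonneg_Reals_mult_I id_minus_T_pow_T_positive)

lemma poly_kernel_T_pos: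
  assumes "nonneg_coeffs p" shows "pos_kernel (poly_kernel (one_minus_X * p))"
  unfolding pos_kernel_def
proof safe
  fix f assume f: "square_integrable M f"
  have "inner_L2 (int_op (poly_kernel (one_minus_X * p)) f) f = inner_L2 (T (int_op (poly_kernel p) f)) f"
    using f by (simp add: kernel_comp_K_poly_kernel[symmetric] int_op_comp K_cont poly_kernel_cont)
  also have "\<dots> = inner_L2 (int_op (poly_kernel p) f) (T f)"
    using f by (simp add: T_symmetric int_op_L2 poly_kernel_cont)
  also have "\<dots> = (\<Sum>k\<le>degree p. of_real (coeff p k) * inner_L2 ((id_minus_T ^^ k) (T f)) (T f))"
    using f by (simp add: inner_L2_poly_kernel T_L2)
  also have "\<dots> \<in> nonneg_Reals"
    using assms f by (auto simp: nonneg_coeffs_def intro!: nonneg_Reals_sum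
      nonneg_Reals_mult_I id_minus_T_pow_positive T_L2)
  finally show "inner_L2 (int_op (poly_kernel (one_minus_X * p)) f) f \<in> nonneg_Reals" .
qed

text \<open>
  Symmetry of \<open>T\<close> gives the identity for averages of \<open>K\<close> over small balls, and these converge to the
  values of \<open>K\<close> by continuity.
\<close>

lemma K_hermitian: "K x y = cnj (K y x)"
proof (cases "x \<in> space M \<and> y \<in> space M")
  case True
  then have x: "x \<in> space M" and y: "y \<in> space M" by auto
  have "inner_L2 (T (cap y n)) (cap x n) = cnj (inner_L2 (T (cap x n)) (cap y n))" for n
    using T_symmetric[OF cap_L2 cap_L2] inner_L2_commute by metis
  then show ?thesis
    using cap_limit[OF K_cont x y] tendsto_cnj[OF cap_limit[OF K_cont y x]] LIMSEQ_unique
    by simp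
next
  case False
  then show ?thesis using cont_kernel_outside[OF K_cont] by auto
qed

lemma basis_kernel_hermitian: "basis_kernel k x y = cnj (basis_kernel k y x)"
proof (induction k arbitrary: x y)
  case 0
  show ?case unfolding basis_kernel.simps by (rule K_hermitian)
next
  case (Suc k)
  have "basis_kernel k = poly_kernel (monom 1 k)"
  proof (intro ext)
    fix x y
    have "poly_kernel (monom 1 k) x y = (\<Sum>i\<le>k. if i = k then basis_kernel k x y else 0)"
      unfolding poly_kernel_eq[OF degree_monom_le] by (intro sum.cong) auto
    then show "basis_kernel k x y = poly_kernel (monom 1 k) x y" by simp
  qed
  then have comm: "kernel_comp K (basis_kernel k) = kernel_comp (basis_kernel k) K"
    using kernel_comp_poly_kernel[of 1 "monom 1 k"] kernel_comp_poly_kernel[of "monom 1 k" 1]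
    by (simp add: poly_kernel_1)
  have "cnj (kernel_comp K (basis_kernel k) y x) = (\<integral>\<xi>. cnj (K y \<xi>) * cnj (basis_kernel k \<xi> x) \<partial>M)"
    unfolding kernel_comp_def complex_cnj_mult[symmetric] by (rule Bochner_Integration.integral_cnj[symmetric])
  also have "\<dots> = (\<integral>\<xi>. basis_kernel k x \<xi> * K \<xi> y \<partial>M)"
    by (simp add: Suc[symmetric] K_hermitian[symmetric] mult.commute)
  also have "\<dots> = kernel_comp K (basis_kernel k) x y"
    unfolding comm by (simp add: kernel_comp_def)
  finally show ?case
    unfolding basis_kernel.simps complex_cnj_diff Suc[of x y, symmetric] by simp
qed

lemma poly_kernel_hermitian: "poly_kernel p x y = cnj (poly_kernel p y x)"
proof -
  have "cnj (basis_kernel k y x) = basis_kernel k x y" for k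
    by (rule basis_kernel_hermitian[symmetric])
  then show ?thesis unfolding poly_kernel_def by simp
qed

text \<open>
  For a Hermitian kernel the squared norm of the section at \<open>x\<close> is the diagonal value of the kernel
  composed with itself. This turns operator inequalities into \<open>L\<^sup>2\<close> estimates for sections.
\<close>

lemma poly_kernel_section_norm:
  "of_real (\<integral>\<xi>. (cmod (poly_kernel p x \<xi>))\<^sup>2 \<partial>M) = poly_kernel (one_minus_X * p\<^sup>2) x x"
proof -
  have "of_real (\<integral>\<xi>. (cmod (poly_kernel p x \<xi>))\<^sup>2 \<partial>M) =
      (\<integral>\<xi>. poly_kernel p x \<xi> * cnj (poly_kernel p x \<xi>) \<partial>M)"
    using inner_L2_self[of "poly_kernel p x"] by (simp add: inner_L2_def)
  also have "\<dots> = kernel_comp (poly_kernel p) (poly_kernel p) x x"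
    by (simp add: kernel_comp_def poly_kernel_hermitian[of p _ x, symmetric])
  finally show ?thesis by (simp add: kernel_comp_poly_kernel power2_eq_square)
qed

end

section \<open>The square root of a continuous positive kernel\<close>

context contractive_positive_kernel
begin

definition approx_root :: "nat \<Rightarrow> 'a \<Rightarrow> 'a \<Rightarrow> complex" where
  "approx_root n = poly_kernel (sqrt_poly n)"

text \<open>
  The squared \<open>L\<^sup>2\<close> norm of the section \<open>approx_root n x\<close>, written as the diagonal value at \<open>x\<close> of the kernel of
  the squared operator.
\<close>

definition approx_diag :: "nat \<Rightarrow> 'a \<Rightarrow> real" where
  "approx_diag n x = Re (poly_kernel (one_minus_X * (sqrt_poly n)\<^sup>2) x x)"

lemma approx_root_cont: "cont_kernel (approx_root n)"
  unfolding approx_root_def by (rule poly_kernel_cont)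

lemma approx_root_hermitian: "approx_root n x y = cnj (approx_root n y x)"
  unfolding approx_root_def by (rule poly_kernel_hermitian)

lemma approx_root_pos: "pos_kernel (approx_root n)"
  unfolding approx_root_def by (intro poly_kernel_pos nonneg_coeffs_sqrt_poly)

lemma approx_root_section_norm: "(\<integral>\<xi>. (cmod (approx_root n x \<xi>))\<^sup>2 \<partial>M) = approx_diag n x"
  unfolding approx_root_def approx_diag_def poly_kernel_section_norm[symmetric] by simp

text \<open>
  For commuting positive operators \<open>A = p\<^sub>m(T)\<close> and \<open>A + D = p\<^sub>n(T)\<close> with \<open>D \<ge> 0\<close> one has
  \<open>(A + D)\<^sup>2 - A\<^sup>2 - D\<^sup>2 = 2 A D \<ge> 0\<close>; the inequality is read off on the diagonal.
\<close>

lemma approx_root_section_dist: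
  assumes "m \<le> n"
  shows "(\<integral>\<xi>. (cmod (approx_root n x \<xi> - approx_root m x \<xi>))\<^sup>2 \<partial>M) \<le> approx_diag n x - approx_diag m x"
proof -
  let ?p = "sqrt_poly m" and ?d = "sqrt_poly n - sqrt_poly m"
  have "poly_kernel (one_minus_X * (?p * ?d + ?p * ?d)) x x \<in> nonneg_Reals"
    by (intro pos_kernel_diagonal poly_kernel_cont poly_kernel_T_pos nonneg_coeffs_add nonneg_coeffs_mult
        nonneg_coeffs_sqrt_poly nonneg_coeffs_sqrt_poly_diff assms)
  then have "0 \<le> Re (poly_kernel (one_minus_X * (?p * ?d + ?p * ?d)) x x)"
    by (simp add: complex_nonneg_Reals_iff)
  also have "one_minus_X * (?p * ?d + ?p * ?d) =
      one_minus_X * (sqrt_poly n)\<^sup>2 - one_minus_X * ?p\<^sup>2 - one_minus_X * ?d\<^sup>2"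
    by (simp add: algebra_simps power2_eq_square)
  also have "Re (poly_kernel \<dots> x x) =
      approx_diag n x - approx_diag m x - Re (poly_kernel (one_minus_X * ?d\<^sup>2) x x)"
    by (simp add: approx_diag_def poly_kernel_diff)
  also have "Re (poly_kernel (one_minus_X * ?d\<^sup>2) x x) = (\<integral>\<xi>. (cmod (approx_root n x \<xi> - approx_root m x \<xi>))\<^sup>2 \<partial>M)"
    unfolding poly_kernel_section_norm[symmetric] by (simp add: approx_root_def poly_kernel_diff)
  finally show ?thesis by simp
qed

lemma approx_diag_mono: "m \<le> n \<Longrightarrow> approx_diag m x \<le> approx_diag n x"
  using order_trans[OF integral_nonneg_AE approx_root_section_dist[of m n x]] by simp

text \<open>
  The residual \<open>T - p\<^sub>n(T)\<^sup>2\<close> is positive, so \<open>\<alpha>\<^sub>n(x) \<le> K(x, x)\<close>. Integrated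
  over \<open>x\<close>, this bounds the Hilbert--Schmidt norms of all \<open>p\<^sub>n(T)\<close> by the trace of \<open>T\<close>, which is why
  the square root is a Hilbert--Schmidt operator.
\<close>

lemma approx_diag_le: "approx_diag n x \<le> 1 / measure M (space M)"
proof -
  have "poly_kernel (1 - one_minus_X * (sqrt_poly n)\<^sup>2) x x \<in> nonneg_Reals"
    by (intro pos_kernel_diagonal poly_kernel_cont poly_kernel_pos nonneg_coeffs_sqrt_residual)
  then have "approx_diag n x \<le> Re (K x x)"
    by (simp add: poly_kernel_diff poly_kernel_1 complex_nonneg_Reals_iff approx_diag_def)
  also have "\<dots> \<le> 1 / measure M (space M)"
    using complex_Re_le_cmod K_bound order_trans by blast
  finally show ?thesis .
qed

lemma approx_root_residual:
  "K x y - kernel_comp (approx_root n) (approx_root n) x y = 2 * (approx_root (Suc n) x y - approx_root n x y)"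
proof -
  have "K x y - kernel_comp (approx_root n) (approx_root n) x y =
      poly_kernel (1 - one_minus_X * (sqrt_poly n)\<^sup>2) x y"
    by (simp add: approx_root_def kernel_comp_poly_kernel poly_kernel_diff poly_kernel_1 power2_eq_square)
  also have "1 - one_minus_X * (sqrt_poly n)\<^sup>2 = smult 2 (sqrt_poly (Suc n) - sqrt_poly n)"
    by simp
  finally show ?thesis by (simp only: poly_kernel_smult poly_kernel_diff approx_root_def) simp
qed

lemma approx_diag_convergent: "convergent (\<lambda>n. approx_diag n x)"
proof (rule Bseq_mono_convergent)
  have "0 \<le> approx_diag n x" for n
    unfolding approx_root_section_norm[symmetric] by (rule integral_nonneg_AE) simp
  then show "Bseq (\<lambda>n. approx_diag n x)"
    using approx_diag_le by (intro BseqI'[of _ "1 / measure M (space M)"]) auto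
  show "\<forall>m. \<forall>n\<ge>m. approx_diag m x \<le> approx_diag n x"
    using approx_diag_mono by blast
qed

sublocale prod: finite_measure "M \<Otimes>\<^sub>M M"
  by (rule finite_measure_pair_measure) unfold_locales

lemma cont_kernel_L2_prod:
  assumes "cont_kernel A" shows "square_integrable (M \<Otimes>\<^sub>M M) (\<lambda>p. A (fst p) (snd p))"
proof -
  obtain a where "\<And>x y. cmod (A x y) \<le> a" using cont_kernel_bounded[OF assms] by metis
  then show ?thesis
    using cont_kernel_measurable[OF assms]
    by (intro prod.square_integrable_bounded[of _ a]) (auto simp: split_beta')
qed

lemma integral_norm_prod:
  assumes "cont_kernel A"
  shows "(\<integral>p. (cmod (A (fst p) (snd p)))\<^sup>2 \<partial>(M \<Otimes>\<^sub>M M)) = (\<integral>x. (\<integral>y. (cmod (A x y))\<^sup>2 \<partial>M) \<partial>M)"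
    and "integrable M (\<lambda>x. \<integral>y. (cmod (A x y))\<^sup>2 \<partial>M)"
proof -
  have int: "integrable (M \<Otimes>\<^sub>M M) (\<lambda>p. (cmod (A (fst p) (snd p)))\<^sup>2)"
    using cont_kernel_L2_prod[OF assms] by (simp add: square_integrable_def)
  show "(\<integral>p. (cmod (A (fst p) (snd p)))\<^sup>2 \<partial>(M \<Otimes>\<^sub>M M)) = (\<integral>x. (\<integral>y. (cmod (A x y))\<^sup>2 \<partial>M) \<partial>M)"
    using integral_fst'[OF int] by simp
  show "integrable M (\<lambda>x. \<integral>y. (cmod (A x y))\<^sup>2 \<partial>M)"
    using integrable_fst'[OF int] by simp
qed

lemma approx_diag_integrable: "integrable M (approx_diag n)"
  using integral_norm_prod(2)[OF approx_root_cont, of n] by (simp add: approx_root_section_norm)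

lemma approx_root_prod_dist:
  assumes "m \<le> n"
  shows "(\<integral>p. (cmod (approx_root n (fst p) (snd p) - approx_root m (fst p) (snd p)))\<^sup>2 \<partial>(M \<Otimes>\<^sub>M M)) \<le>
    (\<integral>x. approx_diag n x \<partial>M) - (\<integral>x. approx_diag m x \<partial>M)"
proof -
  note c = cont_kernel_diff[OF approx_root_cont approx_root_cont, of n m]
  have "(\<integral>p. (cmod (approx_root n (fst p) (snd p) - approx_root m (fst p) (snd p)))\<^sup>2 \<partial>(M \<Otimes>\<^sub>M M)) =
      (\<integral>x. (\<integral>y. (cmod (approx_root n x y - approx_root m x y))\<^sup>2 \<partial>M) \<partial>M)"
    by (rule integral_norm_prod(1)[OF c])
  also have "\<dots> \<le> (\<integral>x. approx_diag n x - approx_diag m x \<partial>M)"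
    by (intro integral_mono integral_norm_prod(2)[OF c] approx_root_section_dist assms
        Bochner_Integration.integrable_diff approx_diag_integrable)
  also have "\<dots> = (\<integral>x. approx_diag n x \<partial>M) - (\<integral>x. approx_diag m x \<partial>M)"
    by (intro Bochner_Integration.integral_diff approx_diag_integrable)
  finally show ?thesis .
qed

text \<open>
  The traces of \<open>p\<^sub>n(T)\<^sup>2\<close> increase and are bounded; by \<open>approx_root_prod_dist\<close> the kernels are then a
  Cauchy sequence in \<open>L\<^sup>2\<close> of the product space.
\<close>

lemma trace_convergent: "convergent (\<lambda>n. \<integral>x. approx_diag n x \<partial>M)"
proof (rule Bseq_mono_convergent)
  have nonneg: "0 \<le> approx_diag n x" for n x
    unfolding approx_root_section_norm[symmetric] by (rule integral_nonneg_AE) simp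
  have "(\<integral>x. approx_diag n x \<partial>M) \<le> (\<integral>x. 1 / measure M (space M) \<partial>M)" for n
    by (intro integral_mono approx_diag_integrable approx_diag_le) simp
  moreover have "0 \<le> (\<integral>x. approx_diag n x \<partial>M)" for n
    using nonneg by (intro integral_nonneg_AE) simp
  ultimately show "Bseq (\<lambda>n. \<integral>x. approx_diag n x \<partial>M)"
    by (intro BseqI'[of _ "\<integral>x. 1 / measure M (space M) \<partial>M"]) (simp only: real_norm_def abs_of_nonneg)
  show "\<forall>m. \<forall>n\<ge>m. (\<integral>x. approx_diag m x \<partial>M) \<le> (\<integral>x. approx_diag n x \<partial>M)"
    by (intro allI impI integral_mono approx_diag_integrable approx_diag_mono)
qed

lemma approx_root_L1_Cauchy:
  assumes "e > 0"
  shows "\<exists>N. \<forall>i\<ge>N. \<forall>j\<ge>N.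
    (\<integral>p. cmod (approx_root i (fst p) (snd p) - approx_root j (fst p) (snd p)) \<partial>(M \<Otimes>\<^sub>M M)) < e"
proof -
  define s where "s = sqrt (measure (M \<Otimes>\<^sub>M M) (space (M \<Otimes>\<^sub>M M)))"
  have s: "s \<ge> 0" by (simp add: s_def)
  define a where "a n = (\<integral>x. approx_diag n x \<partial>M)" for n
  have "Cauchy a"
    using trace_convergent unfolding a_def[abs_def] by (rule convergent_Cauchy)
  moreover have "(e / (s + 1))\<^sup>2 > 0" using assms s by simp
  ultimately obtain N where N: "\<And>i j. i \<ge> N \<Longrightarrow> j \<ge> N \<Longrightarrow> \<bar>a i - a j\<bar> < (e / (s + 1))\<^sup>2"
    unfolding Cauchy_def dist_real_def by blast
  have *: "(\<integral>p. cmod (approx_root i (fst p) (snd p) - approx_root j (fst p) (snd p)) \<partial>(M \<Otimes>\<^sub>M M)) < e"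
    if "i \<ge> N" "j \<ge> N" "j \<le> i" for i j
  proof -
    let ?D = "\<lambda>p. approx_root i (fst p) (snd p) - approx_root j (fst p) (snd p)"
    have D: "square_integrable (M \<Otimes>\<^sub>M M) ?D"
      by (rule cont_kernel_L2_prod[OF cont_kernel_diff[OF approx_root_cont approx_root_cont]])
    have D': "square_integrable (M \<Otimes>\<^sub>M M) (\<lambda>p. of_real (cmod (?D p)))"
      using D by (auto simp: square_integrable_def)
    have one: "square_integrable (M \<Otimes>\<^sub>M M) (\<lambda>_. 1)"
      by (rule prod.square_integrable_bounded[of _ 1]) simp_all
    have "(\<integral>p. (cmod (?D p))\<^sup>2 \<partial>(M \<Otimes>\<^sub>M M)) \<le> a i - a j"
      unfolding a_def by (rule approx_root_prod_dist[OF that(3)])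
    also have "\<dots> \<le> (e / (s + 1))\<^sup>2"
      using N[OF that(1,2)] by simp
    finally have "sqrt (\<integral>p. (cmod (?D p))\<^sup>2 \<partial>(M \<Otimes>\<^sub>M M)) \<le> e / (s + 1)"
      using assms s by (intro real_le_lsqrt) simp_all
    then have "sqrt (\<integral>p. (cmod (?D p))\<^sup>2 \<partial>(M \<Otimes>\<^sub>M M)) * s \<le> e / (s + 1) * s"
      using s by (rule mult_right_mono)
    also have "\<dots> < e"
      using assms s by (simp add: field_simps)
    finally have "sqrt (\<integral>p. (cmod (?D p))\<^sup>2 \<partial>(M \<Otimes>\<^sub>M M)) * s < e" .
    moreover have "(\<integral>p. cmod (?D p) \<partial>(M \<Otimes>\<^sub>M M)) \<le> sqrt (\<integral>p. (cmod (?D p))\<^sup>2 \<partial>(M \<Otimes>\<^sub>M M)) * s"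
    proof -
      have "(\<integral>p. cmod (?D p) \<partial>(M \<Otimes>\<^sub>M M)) \<le> \<bar>\<integral>p. cmod (?D p) \<partial>(M \<Otimes>\<^sub>M M)\<bar>" by simp
      also have "\<dots> = cmod (\<integral>p. of_real (cmod (?D p)) * 1 \<partial>(M \<Otimes>\<^sub>M M))"
        by simp
      also have "\<dots> \<le> sqrt (\<integral>p. (cmod (of_real (cmod (?D p))))\<^sup>2 \<partial>(M \<Otimes>\<^sub>M M)) *
          sqrt (\<integral>p. (cmod 1)\<^sup>2 \<partial>(M \<Otimes>\<^sub>M M))"
        by (rule Cauchy_Schwarz_L2[OF D' one])
      finally show ?thesis by (simp add: s_def)
    qed
    ultimately show ?thesis by simp
  qed
  show ?thesis
  proof (intro exI[of _ N] allI impI)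
    fix i j assume ij: "i \<ge> N" "j \<ge> N"
    show "(\<integral>p. cmod (approx_root i (fst p) (snd p) - approx_root j (fst p) (snd p)) \<partial>(M \<Otimes>\<^sub>M M)) < e"
    proof (cases "j \<le> i")
      case True
      then show ?thesis by (rule *[OF ij])
    next
      case False
      then show ?thesis using *[OF ij(2,1)] by (simp add: norm_minus_commute)
    qed
  qed
qed

lemma approx_root_AE_Cauchy_subsequence:
  obtains r where "strict_mono r" "AE p in M \<Otimes>\<^sub>M M. Cauchy (\<lambda>k. approx_root (r k) (fst p) (snd p))"
proof (rule cauchy_L1_AE_cauchy_subseq[of "M \<Otimes>\<^sub>M M" "\<lambda>n p. approx_root n (fst p) (snd p)"])
  show "integrable (M \<Otimes>\<^sub>M M) (\<lambda>p. approx_root n (fst p) (snd p))" for n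
    by (rule prod.square_integrable_integrable[OF cont_kernel_L2_prod[OF approx_root_cont]])
qed (use approx_root_L1_Cauchy that in auto)

lemma basis_kernel_invariant:
  assumes g: "g \<in> M \<rightarrow>\<^sub>M M" and d: "distr M M g = M"
    and inv: "\<And>x y. x \<in> space M \<Longrightarrow> y \<in> space M \<Longrightarrow> K (g x) (g y) = K x y"
    and xy: "x \<in> space M" "y \<in> space M"
  shows "basis_kernel k (g x) (g y) = basis_kernel k x y"
  using xy
proof (induction k arbitrary: x y)
  case 0
  then show ?case by (simp add: inv)
next
  case (Suc k)
  have "kernel_comp K (basis_kernel k) (g x) (g y) = (\<integral>\<xi>. K (g x) \<xi> * basis_kernel k \<xi> (g y) \<partial>distr M M g)"
    by (simp add: kernel_comp_def d)
  also have "\<dots> = (\<integral>\<xi>. K (g x) (g \<xi>) * basis_kernel k (g \<xi>) (g y) \<partial>M)"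
    by (rule integral_distr[OF g])
      (intro borel_measurable_times cont_kernel_section_measurable K_cont basis_kernel_cont)
  also have "\<dots> = kernel_comp K (basis_kernel k) x y"
    unfolding kernel_comp_def using Suc by (intro Bochner_Integration.integral_cong) (auto simp: inv)
  finally show ?case using Suc by simp
qed

lemma approx_root_invariant:
  assumes "g \<in> M \<rightarrow>\<^sub>M M" "distr M M g = M"
    and "\<And>x y. x \<in> space M \<Longrightarrow> y \<in> space M \<Longrightarrow> K (g x) (g y) = K x y"
    and "x \<in> space M" "y \<in> space M"
  shows "approx_root n (g x) (g y) = approx_root n x y"
  unfolding approx_root_def poly_kernel_def by (simp only: basis_kernel_invariant[OF assms])

end

locale square_root_sequence = contractive_positive_kernel +
  fixes r :: "nat \<Rightarrow> nat"
  assumes r_mono: "strict_mono r"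
    and r_Cauchy: "AE p in M \<Otimes>\<^sub>M M. Cauchy (\<lambda>k. approx_root (r k) (fst p) (snd p))"
begin

text \<open>
  The value at \<open>(x, y)\<close> depends only on the sequence of approximate values there, so every invariance
  holds at all points. The value \<open>0\<close> where the sequence diverges is compatible with conjugation, which
  the unspecified \<^const>\<open>lim\<close> of a divergent sequence is not, and so keeps the kernel Hermitian.
\<close>

definition root_kernel :: "'a \<Rightarrow> 'a \<Rightarrow> complex" where
  "root_kernel x y = (if Cauchy (\<lambda>k. approx_root (r k) x y) then lim (\<lambda>k. approx_root (r k) x y) else 0)"

text \<open>
  The points, almost all by Fubini's theorem, at which limits of sections can be taken.
\<close>

definition good :: "'a \<Rightarrow> bool" where
  "good x \<longleftrightarrow> x \<in> space M \<and> (AE y in M. (\<lambda>k. approx_root (r k) x y) \<longlonglongrightarrow> root_kernel x y)"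

lemma root_kernel_measurable: "(\<lambda>p. root_kernel (fst p) (snd p)) \<in> borel_measurable (M \<Otimes>\<^sub>M M)"
proof -
  have [measurable]: "(\<lambda>p. approx_root n (fst p) (snd p)) \<in> borel_measurable (M \<Otimes>\<^sub>M M)" for n
    using cont_kernel_measurable[OF approx_root_cont] by (simp add: split_beta')
  show ?thesis unfolding root_kernel_def by measurable
qed

lemma root_kernel_section_measurable: "x \<in> space M \<Longrightarrow> root_kernel x \<in> borel_measurable M"
  using measurable_compose[OF measurable_Pair1' root_kernel_measurable, of x] by simp

lemma root_kernel_hermitian: "root_kernel x y = cnj (root_kernel y x)"
proof -
  have eq: "(\<lambda>k. approx_root (r k) x y) = (\<lambda>k. cnj (approx_root (r k) y x))"
    by (intro ext approx_root_hermitian)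
  have "dist (cnj a) (cnj b) = dist a b" for a b
    by (metis complex_cnj_diff complex_mod_cnj dist_norm)
  then have Cauchy_cnj: "Cauchy (\<lambda>k. cnj (u k)) \<longleftrightarrow> Cauchy u" for u
    by (simp add: Cauchy_def)
  show ?thesis
  proof (cases "Cauchy (\<lambda>k. approx_root (r k) y x)")
    case True
    then obtain l where l: "(\<lambda>k. approx_root (r k) y x) \<longlonglongrightarrow> l"
      by (auto simp: Cauchy_convergent_iff convergent_def)
    then have "(\<lambda>k. approx_root (r k) x y) \<longlonglongrightarrow> cnj l"
      unfolding eq by (rule tendsto_cnj)
    with l True show ?thesis
      by (simp add: root_kernel_def limI LIMSEQ_imp_Cauchy)
  next
    case False
    then show ?thesis unfolding root_kernel_def eq by (simp add: Cauchy_cnj)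
  qed
qed

lemma AE_approx_tendsto_root:
  "AE p in M \<Otimes>\<^sub>M M. (\<lambda>k. approx_root (r k) (fst p) (snd p)) \<longlonglongrightarrow> root_kernel (fst p) (snd p)"
  using r_Cauchy
  by eventually_elim (simp add: root_kernel_def Cauchy_convergent_iff convergent_LIMSEQ_iff)

lemma AE_good: "AE x in M. good x"
  using AE_pair[OF AE_approx_tendsto_root] AE_space by eventually_elim (simp add: good_def)

text \<open>
  By Fatou's lemma the Cauchy estimate for sections survives when one of the two members is replaced
  by the limit, and the increasing sequence \<open>\<alpha>\<^sub>n(x)\<close> converges.
\<close>

lemma good_section:
  assumes "good x"
  shows "square_integrable M (root_kernel x)"
    and "(\<lambda>k. \<integral>\<xi>. (cmod (approx_root (r k) x \<xi> - root_kernel x \<xi>))\<^sup>2 \<partial>M) \<longlonglongrightarrow> 0"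
proof -
  have x: "x \<in> space M" and lim: "AE y in M. (\<lambda>k. approx_root (r k) x y) \<longlonglongrightarrow> root_kernel x y"
    using assms by (auto simp: good_def)
  note L2 = cont_kernel_section_L2(1)[OF approx_root_cont]
  show "square_integrable M (root_kernel x)"
    by (rule square_integrable_Fatou(1)[OF L2 root_kernel_section_measurable[OF x] lim always_eventually,
          where B = "1 / measure M (space M)"])
      (simp add: approx_root_section_norm approx_diag_le)
  obtain l where l: "(\<lambda>n. approx_diag n x) \<longlonglongrightarrow> l"
    using approx_diag_convergent by (auto simp: convergent_def)
  have le_l: "approx_diag n x \<le> l" for n
    using l by (rule incseq_le[rotated]) (simp add: incseq_def approx_diag_mono)
  have bound: "(\<integral>\<xi>. (cmod (approx_root (r k) x \<xi> - root_kernel x \<xi>))\<^sup>2 \<partial>M) \<le> l - approx_diag (r k) x" for k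
  proof (rule square_integrable_Fatou(2))
    show "square_integrable M (\<lambda>\<xi>. approx_root (r k) x \<xi> - approx_root (r j) x \<xi>)" for j
      by (intro square_integrable_diff L2)
    show "(\<lambda>\<xi>. approx_root (r k) x \<xi> - root_kernel x \<xi>) \<in> borel_measurable M"
      by (intro borel_measurable_diff root_kernel_section_measurable x cont_kernel_section_measurable approx_root_cont)
    show "AE \<xi> in M. (\<lambda>j. approx_root (r k) x \<xi> - approx_root (r j) x \<xi>) \<longlonglongrightarrow> approx_root (r k) x \<xi> - root_kernel x \<xi>"
      using lim by eventually_elim (intro tendsto_intros)
    show "\<forall>\<^sub>F j in sequentially. (\<integral>\<xi>. (cmod (approx_root (r k) x \<xi> - approx_root (r j) x \<xi>))\<^sup>2 \<partial>M) \<le>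
        l - approx_diag (r k) x"
      using eventually_ge_at_top[of k]
    proof eventually_elim
      case (elim j)
      then have "r k \<le> r j" using r_mono by (simp add: strict_mono_less_eq)
      from approx_root_section_dist[OF this, of x] le_l[of "r j"] show ?case
        by (simp add: norm_minus_commute)
    qed
  qed
  have "(\<lambda>k. l - approx_diag (r k) x) \<longlonglongrightarrow> l - l"
    by (intro tendsto_diff tendsto_const LIMSEQ_subseq_LIMSEQ[OF l r_mono, unfolded comp_def])
  then have u: "(\<lambda>k. l - approx_diag (r k) x) \<longlonglongrightarrow> 0" by simp
  show "(\<lambda>k. \<integral>\<xi>. (cmod (approx_root (r k) x \<xi> - root_kernel x \<xi>))\<^sup>2 \<partial>M) \<longlonglongrightarrow> 0"
  proof (rule tendsto_sandwich[OF _ _ tendsto_const u])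
    show "\<forall>\<^sub>F k in sequentially. 0 \<le> (\<integral>\<xi>. (cmod (approx_root (r k) x \<xi> - root_kernel x \<xi>))\<^sup>2 \<partial>M)"
      by (intro always_eventually allI integral_nonneg_AE) simp
    show "\<forall>\<^sub>F k in sequentially. (\<integral>\<xi>. (cmod (approx_root (r k) x \<xi> - root_kernel x \<xi>))\<^sup>2 \<partial>M) \<le> l - approx_diag (r k) x"
      by (intro always_eventually allI bound)
  qed
qed

lemma root_kernel_L2: "square_integrable (M \<Otimes>\<^sub>M M) (\<lambda>p. root_kernel (fst p) (snd p))"
proof (rule square_integrable_Fatou(1)[OF _ root_kernel_measurable AE_approx_tendsto_root always_eventually])
  show "square_integrable (M \<Otimes>\<^sub>M M) (\<lambda>p. approx_root (r k) (fst p) (snd p))" for k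
    by (rule cont_kernel_L2_prod[OF approx_root_cont])
  have "(\<integral>p. (cmod (approx_root (r k) (fst p) (snd p)))\<^sup>2 \<partial>(M \<Otimes>\<^sub>M M)) = (\<integral>x. approx_diag (r k) x \<partial>M)" for k
    by (simp add: integral_norm_prod(1)[OF approx_root_cont] approx_root_section_norm)
  also have "(\<integral>x. approx_diag (r k) x \<partial>M) \<le> (\<integral>x. 1 / measure M (space M) \<partial>M)" for k
    by (intro integral_mono approx_diag_integrable approx_diag_le) simp
  finally show "\<forall>k. (\<integral>p. (cmod (approx_root (r k) (fst p) (snd p)))\<^sup>2 \<partial>(M \<Otimes>\<^sub>M M)) \<le>
      (\<integral>x. 1 / measure M (space M) \<partial>M)"
    by blast
qed

text \<open>
  The quadratic form of the limit is a limit of nonnegative numbers. The operators converge pointwise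
  at good points, and the uniform bound on the norms of the sections gives domination.
\<close>

lemma root_kernel_pos: "pos_kernel root_kernel"
  unfolding pos_kernel_def
proof safe
  fix f assume f: "square_integrable M f"
  have fm: "f \<in> borel_measurable M" using f by (simp add: square_integrable_def)
  let ?c = "sqrt (1 / measure M (space M)) * sqrt (\<integral>y. (cmod (f y))\<^sup>2 \<partial>M)"
  have lim: "AE x in M. (\<lambda>k. int_op (approx_root (r k)) f x) \<longlonglongrightarrow> int_op root_kernel f x"
    using AE_good
  proof eventually_elim
    case (elim x)
    show ?case
      unfolding int_op_def
      by (rule tendsto_integral_mult_L2[OF cont_kernel_section_L2(1)[OF approx_root_cont] good_section(1)[OF elim]
            f f good_section(2)[OF elim]]) simp
  qed
  have bound: "cmod (int_op (approx_root n) f x) \<le> ?c" for n x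
  proof -
    have "cmod (int_op (approx_root n) f x) \<le>
        sqrt (\<integral>y. (cmod (approx_root n x y))\<^sup>2 \<partial>M) * sqrt (\<integral>y. (cmod (f y))\<^sup>2 \<partial>M)"
      unfolding int_op_def by (rule Cauchy_Schwarz_L2[OF cont_kernel_section_L2(1)[OF approx_root_cont] f])
    also have "\<dots> \<le> ?c"
      unfolding approx_root_section_norm by (intro mult_right_mono real_sqrt_le_mono approx_diag_le) simp
    finally show ?thesis .
  qed
  have "(\<lambda>k. inner_L2 (int_op (approx_root (r k)) f) f) \<longlonglongrightarrow> inner_L2 (int_op root_kernel f) f"
    unfolding inner_L2_def
  proof (rule integral_dominated_convergence[where w = "\<lambda>x. ?c * cmod (f x)"])
    have cf: "(\<lambda>x. cnj (f x)) \<in> borel_measurable M"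
      using square_integrable_cnj[OF f] by (simp add: square_integrable_def)
    show "(\<lambda>x. int_op root_kernel f x * cnj (f x)) \<in> borel_measurable M"
      using root_kernel_measurable by (intro borel_measurable_times cf int_op_measurable fm) (simp add: split_beta')
    show "(\<lambda>x. int_op (approx_root (r k)) f x * cnj (f x)) \<in> borel_measurable M" for k
      by (intro borel_measurable_times cf int_op_measurable fm cont_kernel_measurable approx_root_cont)
    show "integrable M (\<lambda>x. ?c * cmod (f x))"
      using square_integrable_integrable[OF f] by simp
    show "AE x in M. (\<lambda>k. int_op (approx_root (r k)) f x * cnj (f x)) \<longlonglongrightarrow> int_op root_kernel f x * cnj (f x)"
      using lim by eventually_elim (intro tendsto_mult tendsto_const)
    show "AE x in M. norm (int_op (approx_root (r k)) f x * cnj (f x)) \<le> ?c * cmod (f x)" for k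
      unfolding norm_mult complex_mod_cnj by (intro AE_I2 mult_right_mono bound) simp
  qed
  then show "inner_L2 (int_op root_kernel f) f \<in> nonneg_Reals"
    by (rule closed_sequentially[OF closed_nonneg_Reals_complex, rotated])
      (use approx_root_pos f in \<open>simp add: pos_kernel_def\<close>)
qed

lemma root_kernel_comp_measurable:
  "(\<lambda>p. kernel_comp root_kernel root_kernel (fst p) (snd p)) \<in> borel_measurable (M \<Otimes>\<^sub>M M)"
  unfolding kernel_comp_def
proof (rule sigma_finite_measure.borel_measurable_lebesgue_integral)
  show "sigma_finite_measure M" by unfold_locales
  have "(\<lambda>q. root_kernel (fst (fst q)) (snd q)) \<in> borel_measurable ((M \<Otimes>\<^sub>M M) \<Otimes>\<^sub>M M)"
    "(\<lambda>q. root_kernel (snd q) (snd (fst q))) \<in> borel_measurable ((M \<Otimes>\<^sub>M M) \<Otimes>\<^sub>M M)"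
    using measurable_compose[OF _ root_kernel_measurable, of "\<lambda>q. (fst (fst q), snd q)" "(M \<Otimes>\<^sub>M M) \<Otimes>\<^sub>M M"]
      measurable_compose[OF _ root_kernel_measurable, of "\<lambda>q. (snd q, snd (fst q))" "(M \<Otimes>\<^sub>M M) \<Otimes>\<^sub>M M"]
    by simp_all
  then show "(\<lambda>(p, \<xi>). root_kernel (fst p) \<xi> * root_kernel \<xi> (snd p)) \<in> borel_measurable ((M \<Otimes>\<^sub>M M) \<Otimes>\<^sub>M M)"
    unfolding split_beta' by (rule borel_measurable_times)
qed

text \<open>
  At good points \<open>x\<close> and \<open>y\<close> the values of the composed approximations, being inner products of
  sections, converge to those of the composed limit. So the residuals \<open>2 (P\<^sub>n\<^sub>+\<^sub>1 - P\<^sub>n)(x, y)\<close> converge for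
  almost every \<open>y\<close>; as their norms in \<open>L\<^sup>2\<close> tend to \<open>0\<close>, so does their pointwise limit vanish.
\<close>

lemma root_kernel_square_section:
  assumes x: "good x"
  shows "AE y in M. K x y = kernel_comp root_kernel root_kernel x y"
proof -
  let ?D = "\<lambda>y. K x y - kernel_comp root_kernel root_kernel x y"
  let ?u = "\<lambda>k y. 2 * (approx_root (Suc (r k)) x y - approx_root (r k) x y)"
  have xs: "x \<in> space M" using x by (simp add: good_def)
  have lim: "AE y in M. (\<lambda>k. ?u k y) \<longlonglongrightarrow> ?D y"
    using AE_good
  proof eventually_elim
    case (elim y)
    have "(\<lambda>k. \<integral>\<xi>. approx_root (r k) x \<xi> * cnj (approx_root (r k) y \<xi>) \<partial>M) \<longlonglongrightarrow>
        (\<integral>\<xi>. root_kernel x \<xi> * cnj (root_kernel y \<xi>) \<partial>M)"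
    proof (rule tendsto_integral_mult_L2)
      have "cmod (cnj (approx_root (r k) y \<xi>) - cnj (root_kernel y \<xi>)) = cmod (approx_root (r k) y \<xi> - root_kernel y \<xi>)" for k \<xi>
        by (metis complex_cnj_diff complex_mod_cnj)
      then show "(\<lambda>k. \<integral>\<xi>. (cmod (cnj (approx_root (r k) y \<xi>) - cnj (root_kernel y \<xi>)))\<^sup>2 \<partial>M) \<longlonglongrightarrow> 0"
        using good_section(2)[OF elim] by simp
    qed (intro square_integrable_cnj cont_kernel_section_L2 approx_root_cont good_section x elim)+
    then have "(\<lambda>k. kernel_comp (approx_root (r k)) (approx_root (r k)) x y) \<longlonglongrightarrow> kernel_comp root_kernel root_kernel x y"
      unfolding kernel_comp_def approx_root_hermitian[of _ y, symmetric] root_kernel_hermitian[of y, symmetric]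
      by (simp add: approx_root_hermitian[of _ _ y, symmetric] root_kernel_hermitian[of _ y, symmetric])
    then show ?case
      unfolding approx_root_residual[symmetric] by (intro tendsto_intros)
  qed
  have um: "square_integrable M (?u k)" for k
    by (intro square_integrable_cmult square_integrable_diff cont_kernel_section_L2 approx_root_cont)
  have "(\<lambda>y. kernel_comp root_kernel root_kernel x y) \<in> borel_measurable M"
    using measurable_compose[OF measurable_Pair1'[OF xs] root_kernel_comp_measurable] by simp
  then have Dm: "?D \<in> borel_measurable M"
    using cont_kernel_section_measurable(1)[OF K_cont] by simp
  obtain l where l: "(\<lambda>n. approx_diag n x) \<longlonglongrightarrow> l"
    using approx_diag_convergent by (auto simp: convergent_def)
  have "(\<lambda>n. 4 * (approx_diag (Suc n) x - approx_diag n x)) \<longlonglongrightarrow> 4 * (l - l)"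
    by (intro tendsto_intros LIMSEQ_Suc l)
  from LIMSEQ_subseq_LIMSEQ[OF this r_mono]
  have bl: "(\<lambda>k. 4 * (approx_diag (Suc (r k)) x - approx_diag (r k) x)) \<longlonglongrightarrow> 0"
    by (simp add: comp_def)
  have ub: "(\<integral>y. (cmod (?u k y))\<^sup>2 \<partial>M) \<le> 4 * (approx_diag (Suc (r k)) x - approx_diag (r k) x)" for k
    unfolding norm_mult power_mult_distrib using approx_root_section_dist[of "r k" "Suc (r k)" x] by simp
  have le: "square_integrable M ?D \<and> (\<integral>y. (cmod (?D y))\<^sup>2 \<partial>M) \<le> e" if "e > 0" for e
  proof -
    have "\<forall>\<^sub>F k in sequentially. (\<integral>y. (cmod (?u k y))\<^sup>2 \<partial>M) \<le> e"
      using order_tendstoD(2)[OF bl that]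
    proof eventually_elim
      case (elim k)
      then show ?case using ub[of k] by simp
    qed
    then show ?thesis
      using square_integrable_Fatou[OF um Dm lim] by blast
  qed
  have "(\<integral>y. (cmod (?D y))\<^sup>2 \<partial>M) \<le> 0"
    by (rule field_le_epsilon) (use le in simp)
  then have "(\<integral>y. (cmod (?D y))\<^sup>2 \<partial>M) = 0"
    by (intro antisym integral_nonneg_AE) simp_all
  moreover have "integrable M (\<lambda>y. (cmod (?D y))\<^sup>2)"
    using le[of 1] by (simp add: square_integrable_def)
  ultimately have "AE y in M. (cmod (?D y))\<^sup>2 = 0"
    by (subst (asm) integral_nonneg_eq_0_iff_AE) auto
  then show ?thesis by eventually_elim simp
qed

lemma root_kernel_square: "AE p in M \<Otimes>\<^sub>M M. K (fst p) (snd p) = kernel_comp root_kernel root_kernel (fst p) (snd p)"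
proof (rule AE_pair_measure)
  have "(\<lambda>p. K (fst p) (snd p)) \<in> borel_measurable (M \<Otimes>\<^sub>M M)"
    using cont_kernel_measurable[OF K_cont] by (simp add: split_beta')
  with root_kernel_comp_measurable
  show "{p \<in> space (M \<Otimes>\<^sub>M M). K (fst p) (snd p) = kernel_comp root_kernel root_kernel (fst p) (snd p)} \<in> sets (M \<Otimes>\<^sub>M M)"
    by measurable
  show "AE x in M. AE y in M. K (fst (x, y)) (snd (x, y)) = kernel_comp root_kernel root_kernel (fst (x, y)) (snd (x, y))"
    using AE_good by eventually_elim (simp add: root_kernel_square_section)
qed

lemma root_kernel_invariant:
  assumes "g \<in> M \<rightarrow>\<^sub>M M" "distr M M g = M"
    and "\<And>x y. x \<in> space M \<Longrightarrow> y \<in> space M \<Longrightarrow> K (g x) (g y) = K x y"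
    and "x \<in> space M" "y \<in> space M"
  shows "root_kernel (g x) (g y) = root_kernel x y"
  by (simp add: root_kernel_def approx_root_invariant[OF assms])

end

theorem (in contractive_positive_kernel) positive_square_root_kernel:
  obtains P where
    "square_integrable (M \<Otimes>\<^sub>M M) (\<lambda>p. P (fst p) (snd p))" "pos_kernel P"
    "AE p in M \<Otimes>\<^sub>M M. K (fst p) (snd p) = kernel_comp P P (fst p) (snd p)"
    "\<forall>g. g \<in> M \<rightarrow>\<^sub>M M \<and> distr M M g = M \<and> (\<forall>x\<in>space M. \<forall>y\<in>space M. K (g x) (g y) = K x y) \<longrightarrow>
      (\<forall>x\<in>space M. \<forall>y\<in>space M. P (g x) (g y) = P x y)"
proof -
  obtain r where "strict_mono r" "AE p in M \<Otimes>\<^sub>M M. Cauchy (\<lambda>k. approx_root (r k) (fst p) (snd p))"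
    by (rule approx_root_AE_Cauchy_subsequence)
  then interpret square_root_sequence M K r
    by unfold_locales
  show ?thesis
    by (rule that[OF root_kernel_L2 root_kernel_pos root_kernel_square]) (simp add: root_kernel_invariant)
qed

section \<open>Kernels on the complex sphere\<close>

lemma compact_measure_space_surface_measure:
  "compact_measure_space (surface_measure :: (complex ^ 'q) measure)"
proof (intro compact_measure_space.intro compact_measure_space_axioms.intro finite_measureI)
  show "emeasure (surface_measure :: (complex ^ 'q) measure) (space surface_measure) \<noteq> \<infinity>"
    by (simp add: space_surface_measure emeasure_surface_measure_space)
  show "compact (space (surface_measure :: (complex ^ 'q) measure))"
    by (simp add: space_surface_measure)
  show "sets (surface_measure :: (complex ^ 'q) measure) =
      sets (restrict_space borel (space surface_measure))"
    by (simp add: space_surface_measure sets_surface_measure)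
  show "emeasure surface_measure (U \<inter> space surface_measure) > 0"
    if "open U" "U \<inter> space surface_measure \<noteq> {}" for U :: "(complex ^ 'q) set"
    using that surface_measure_open_pos by (simp add: space_surface_measure)
qed

lemma square_integrable_scaled:
  assumes "square_integrable M (\<lambda>p. P (fst p) (snd p))"
  shows "square_integrable M (\<lambda>(x, y). c * P x y)"
  using square_integrable_cmult[OF assms, of c] by (simp add: split_beta')

theorem theorem3p9:
  fixes K :: "complex ^ 'q \<Rightarrow> complex ^ 'q \<Rightarrow> complex"
  assumes "continuous_on (csphere \<times> csphere) (\<lambda>(x, y). K x y)"
    and "zonal K"
    and "L2_positive_definite K"
  shows "\<exists>P \<in> zonal_L2_kernels. L2_positive_definite P \<and>
           (AE (x, y) in surface_measure \<Otimes>\<^sub>M surface_measure. K x y = gen_convolution P P x y)"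
proof -
  let ?\<sigma> = "surface_measure :: (complex ^ 'q) measure"
  interpret S: compact_measure_space ?\<sigma>
    by (rule compact_measure_space_surface_measure)
  note space = space_surface_measure[where 'q = 'q]
  define m where "m = sphere_area CARD('q)"
  have m: "m > 0" by (simp add: m_def sphere_area_def)
  have mass: "measure ?\<sigma> (space ?\<sigma>) = m"
    using m emeasure_surface_measure_space[where 'q = 'q]
    by (simp add: measure_def space m_def)
  \<comment> \<open>Values of \<open>K\<close> off the sphere are arbitrary; they are replaced by \<open>0\<close>.\<close>
  define K0 where "K0 x y = (if x \<in> csphere \<and> y \<in> csphere then K x y else 0)" for x y
  have K0: "S.cont_kernel K0"
    unfolding S.cont_kernel_def space
  proof
    show "continuous_on (csphere \<times> csphere) (\<lambda>(x, y). K0 x y)"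
      using assms(1) by (rule continuous_on_cong[THEN iffD1, rotated 2]) (auto simp: K0_def)
  qed (auto simp: K0_def)
  obtain b where b: "b \<ge> 0" "\<And>x y. cmod (K0 x y) \<le> b"
    using S.cont_kernel_bounded[OF K0] by metis
  \<comment> \<open>A factor that makes the operator a contraction; adding \<open>1\<close> to \<open>b\<close> avoids division by zero.\<close>
  define a where "a = 1 / ((b + 1) * m)"
  have a: "a > 0" using b m by (simp add: a_def)
  let ?L = "\<lambda>x y. of_real a * K0 x y"
  interpret L: contractive_positive_kernel ?\<sigma> ?L
  proof
    show "S.cont_kernel ?L" by (rule S.cont_kernel_cmult[OF K0])
    show "cmod (of_real a * K0 x y) \<le> 1 / measure ?\<sigma> (space ?\<sigma>)" for x y
    proof -
      have "cmod (of_real a * K0 x y) \<le> a * (b + 1)"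
        using a b(2)[of x y] by (simp add: norm_mult)
      also have "\<dots> = 1 / m" using b by (simp add: a_def)
      finally show ?thesis by (simp add: mass)
    qed
    show "S.pos_kernel ?L"
      unfolding S.pos_kernel_def
    proof safe
      fix f assume f: "square_integrable ?\<sigma> f"
      have "S.inner_L2 (S.int_op ?L f) f =
          (\<integral>x. of_real a * ((\<integral>y. K x y * f y \<partial>?\<sigma>) * cnj (f x)) \<partial>?\<sigma>)"
        unfolding S.inner_L2_def
      proof (intro Bochner_Integration.integral_cong refl)
        fix x assume x: "x \<in> space ?\<sigma>"
        have "S.int_op ?L f x = (\<integral>y. of_real a * (K x y * f y) \<partial>?\<sigma>)"
          unfolding S.int_op_def using x
          by (intro Bochner_Integration.integral_cong refl) (simp add: K0_def space)
        then show "S.int_op ?L f x * cnj (f x) = of_real a * ((\<integral>y. K x y * f y \<partial>?\<sigma>) * cnj (f x))"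
          by simp
      qed
      also have "\<dots> = of_real a * (\<integral>x. (\<integral>y. K x y * f y \<partial>?\<sigma>) * cnj (f x) \<partial>?\<sigma>)"
        by simp
      also have "\<dots> \<in> nonneg_Reals"
        using assms(3) f a by (intro nonneg_Reals_mult_I) (simp_all add: L2_positive_definite_def)
      finally show "S.inner_L2 (S.int_op ?L f) f \<in> nonneg_Reals" .
    qed
  qed
  obtain P where P_L2: "square_integrable (?\<sigma> \<Otimes>\<^sub>M ?\<sigma>) (\<lambda>p. P (fst p) (snd p))"
    and P_pos: "S.pos_kernel P"
    and P_sq: "AE p in ?\<sigma> \<Otimes>\<^sub>M ?\<sigma>. of_real a * K0 (fst p) (snd p) = S.kernel_comp P P (fst p) (snd p)"
    and P_inv: "\<forall>g. g \<in> ?\<sigma> \<rightarrow>\<^sub>M ?\<sigma> \<and> distr ?\<sigma> ?\<sigma> g = ?\<sigma> \<and>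
      (\<forall>x\<in>space ?\<sigma>. \<forall>y\<in>space ?\<sigma>. ?L (g x) (g y) = ?L x y) \<longrightarrow>
      (\<forall>x\<in>space ?\<sigma>. \<forall>y\<in>space ?\<sigma>. P (g x) (g y) = P x y)"
    by (rule L.positive_square_root_kernel)
  \<comment> \<open>\<open>s\<^sup>2 = m / a\<close> undoes the scaling by \<open>a\<close> and the division by \<open>m\<close> in the convolution.\<close>
  define s where "s = sqrt (m / a)"
  have s: "s \<ge> 0" "s * s = m / a"
    using m a by (simp_all add: s_def)
  let ?P = "\<lambda>x y. of_real s * P x y"
  have L2: "L2_kernel ?P"
    unfolding L2_kernel_def by (rule square_integrable_scaled[OF P_L2])
  have zonal: "zonal ?P"
    unfolding zonal_def
  proof (intro allI impI ballI)
    fix \<rho> :: "complex ^ 'q \<Rightarrow> complex ^ 'q" and x y :: "complex ^ 'q"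
    assume \<rho>: "unitary_operator \<rho>" and xy: "x \<in> csphere" "y \<in> csphere"
    have "\<forall>x\<in>space ?\<sigma>. \<forall>y\<in>space ?\<sigma>. ?L (\<rho> x) (\<rho> y) = ?L x y"
      using assms(2) \<rho> by (simp add: K0_def space unitary_operator_norm zonal_def)
    then have "P (\<rho> x) (\<rho> y) = P x y"
      using P_inv \<rho> xy measurable_unitary_sphere distr_surface_measure_unitary space by blast
    then show "?P (\<rho> x) (\<rho> y) = ?P x y" by simp
  qed
  have pos: "L2_positive_definite ?P"
    unfolding L2_positive_definite_def
  proof (intro conjI allI impI)
    fix f assume f: "square_integrable ?\<sigma> f"
    have "(\<integral>x. (\<integral>y. ?P x y * f y \<partial>?\<sigma>) * cnj (f x) \<partial>?\<sigma>) =
        of_real s * S.inner_L2 (S.int_op P f) f"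
      by (simp add: S.inner_L2_def S.int_op_def mult.assoc)
    also have "\<dots> \<in> nonneg_Reals"
      using P_pos f s by (intro nonneg_Reals_mult_I) (simp_all add: S.pos_kernel_def)
    finally show "(\<integral>x. (\<integral>y. ?P x y * f y \<partial>?\<sigma>) * cnj (f x) \<partial>?\<sigma>) \<in> nonneg_Reals" .
  qed (rule L2)
  have "AE p in ?\<sigma> \<Otimes>\<^sub>M ?\<sigma>. K (fst p) (snd p) = gen_convolution ?P ?P (fst p) (snd p)"
    using P_sq AE_space
  proof eventually_elim
    case (elim p)
    have "gen_convolution ?P ?P (fst p) (snd p) =
        (\<integral>\<xi>. of_real (s * s) * (P (fst p) \<xi> * P \<xi> (snd p)) \<partial>?\<sigma>) / of_real m"
      unfolding gen_convolution_def m_def[symmetric] by (simp add: mult_ac)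
    also have "\<dots> = of_real (s * s) * S.kernel_comp P P (fst p) (snd p) / of_real m"
      by (simp add: S.kernel_comp_def)
    also have "\<dots> = K0 (fst p) (snd p)"
      unfolding elim(1)[symmetric] s(2) using a m by simp
    also have "\<dots> = K (fst p) (snd p)"
      using elim(2) by (auto simp: K0_def space_pair_measure space)
    finally show ?case by simp
  qed
  then show ?thesis
    using L2 zonal pos by (intro bexI[of _ ?P]) (auto simp: zonal_L2_kernels_def split_beta')
qed

end
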